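(* Let $E$ be a real vector space of dimension $n\ge 1$ with a non-degenerate scalar product $(-,-)$ which is either Euclidean or of Lorentzian signature $(+-\cdots-)$, and let $W=\Lambda^{n-1}(E)\simeq E^*$ be identified with $E^*$ and equipped with the scalar product dual to that of $E$. Let $Q\subset E$ be a full-dimensional convex polytope and $\mathcal P$ a polyhedral subdivision of $Q$ with dual graph $\widetilde\Gamma=\widetilde\Gamma_{\mathcal P}$. For each edge $e$ of $\widetilde\Gamma$ let $F_e$ be the corresponding facet (of one polytope $P$, or of two polytopes $P,P'$, from $\mathcal P$). Assume that $(\nu_P(F_e),\nu_P(F_e))\ge 0$ for all $e$, and let $m_e\ge 0$ be the non-negative square root of this number. If $\mathcal P$ is regular, then the scattering diagram $\nu_{\mathcal P}=(\nu_P(F))_{P\supset F}$ labelled by $\widetilde\Gamma$ represents a real Landau singularity for $\widetilde\Gamma$, the mass of the particle associated to the edge $e$ being $m_e$. That is, the collection of its external momenta (the $\nu_P(F)$ for the facets $F$ of polytopes $P\in\mathcal P$ lying on the boundary of $Q$) is a real Landau singularity with intermediate momenta given by the $\nu_P(F)$ for the internal facets $F$.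
   Context: Convex polytope: convex hull of a finite set of points. A facet is a codimension-one face. Weighted normals. Fix a translation-invariant volume form $\mathrm{vol}$ on $E$ compatible with the scalar product (absolute value $1$ on an orthonormal basis); it orients $E$ and trivializes $\Lambda^n(E)$, so $W=\Lambda^{n-1}(E)\simeq E^*\otimes\Lambda^n(E)\simeq E^*$. For a full-dimensional convex polytope $P\subset E$ and a facet $F$ of $P$, the weighted normal $\nu_P(F)\in W$ is $\int_F\Omega$, where $\Omega$ is the tautological constant $\Lambda^{n-1}(E)$-valued $(n-1)$-form on $E$ and $F$ is oriented as part of the boundary of $P$ (outward normal). As an element of $E^*$: $\nu_P(F)(x)=\int_F\iota_x\mathrm{vol}$ for $x\in E$; it vanishes on the directions of $F$ and is positive on vectors pointing out of $P$ through $F$. In the Euclidean case it corresponds to the outward normal vector of length equal to the $(n-1)$-volume of $F$. Subdivisions. A polyhedral subdivision $\mathcal P$ of $Q$ is a finite collection of full-dimensional convex polytopes with union $Q$ such that the intersection of any two distinct members is a (possibly empty) proper face of both. Its dual graph $\widetilde\Gamma_{\mathcal P}$ has the polytopes $P\in\mathcal P$ as vertices and the facets of these polytopes as edges: an internal facet (common to two polytopes $P,P'$) is an edge joining $P$ and $P'$; a facet contained in the boundary of $Q$ belongs to exactly one $P$ and is a leg (an edge with one free end) at $P$. $\mathcal P$ is regular if there is a continuous convex function $f:Q\to\mathbb R$ that is affine-linear on each $P\in\mathcal P$ and strictly convex with respect to $\mathcal P$, i.e. breaks along each internal facet (its affine-linear pieces on the two adjacent polytopes are different). Scattering diagrams.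 Let $\widetilde\Gamma$ be a finite connected graph with legs and without loop edges. A scattering diagram labelled by $\widetilde\Gamma$ with values in $W$ is a collection of vectors $\sigma(v,e)\in W$ for all incident pairs (vertex $v$, edge or leg $e$) such that $\sigma(v,e)=-\sigma(w,e)$ for each non-leg edge $e=[v,w]$, and $\sum_{e\ni v}\sigma(v,e)=0$ for each vertex $v$ (sum over all edges and legs at $v$). Its external momenta are $p_l=\sigma(\varepsilon(l),l)$, where $l$ is a leg and $\varepsilon(l)$ its vertex; its intermediate momenta are the $\sigma(v,e)$ for non-leg edges $e$. The scattering diagram $\nu_{\mathcal P}$ is $\sigma(P,F)=\nu_P(F)$. Real Landau singularity. Let masses $m_e\ge0$ be assigned to the edges of $\widetilde\Gamma$. The collection $p=(p_l)$ of external momenta of a scattering diagram $\sigma$ is a real Landau singularity for $\widetilde\Gamma$, with intermediate momenta $\sigma(v,e)$, if $(\sigma(v,e),\sigma(v,e))=m_e^2$ for each non-leg edge $e$, and there exist numbers $\alpha_e>0$ (Landau multipliers) for all non-leg edges $e$ and a map $\varphi:\mathrm{Vert}(\widetilde\Gamma)\to W$ such that $\alpha_e\,\sigma(v,e)=\varphi(v)-\varphi(w)$ for each non-leg edge $e=[v,w]$ and each of its two ends $v$. *)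

theory Defs
  imports "HOL-Analysis.Analysis"
begin

text \<open>
  The space \<open>E\<close> is an arbitrary type of class \<open>euclidean_space\<close>. The inner product that comes with
  the class only serves to provide the topology; the scalar product of the
  theorem is a separate bilinear form \<open>g\<close>.
\<close>

definition orthonormal_basis_for :: "('a::euclidean_space \<Rightarrow> 'a \<Rightarrow> real) \<Rightarrow> 'a list \<Rightarrow> bool" where
  "orthonormal_basis_for g bs \<longleftrightarrow>
     length bs = DIM('a) \<and> distinct bs \<and> independent (set bs) \<and>
     (\<forall>i<length bs. \<bar>g (bs ! i) (bs ! i)\<bar> = 1) \<and>
     (\<forall>i<length bs. \<forall>j<length bs. i \<noteq> j \<longrightarrow> g (bs ! i) (bs ! j) = 0)"

definition symmetric_bilinear :: "('a::euclidean_space \<Rightarrow> 'a \<Rightarrow> real) \<Rightarrow> bool" where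
  "symmetric_bilinear g \<longleftrightarrow> bilinear g \<and> (\<forall>x y. g x y = g y x)"

definition euclidean_product :: "('a::euclidean_space \<Rightarrow> 'a \<Rightarrow> real) \<Rightarrow> bool" where
  "euclidean_product g \<longleftrightarrow> symmetric_bilinear g \<and> (\<forall>x. x \<noteq> 0 \<longrightarrow> g x x > 0)"

definition lorentzian_product :: "('a::euclidean_space \<Rightarrow> 'a \<Rightarrow> real) \<Rightarrow> bool" where
  "lorentzian_product g \<longleftrightarrow> symmetric_bilinear g \<and>
     (\<exists>bs. orthonormal_basis_for g bs \<and> g (bs ! 0) (bs ! 0) = 1 \<and>
           (\<forall>i. 0 < i \<and> i < length bs \<longrightarrow> g (bs ! i) (bs ! i) = - 1))"

text \<open>The dual space \<open>E\<^sup>*\<close> is \<open>'a \<Rightarrow>\<^sub>L real\<close>: in finite dimension every linear functional is bounded.\<close>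

definition sharp :: "('a::euclidean_space \<Rightarrow> 'a \<Rightarrow> real) \<Rightarrow> ('a \<Rightarrow>\<^sub>L real) \<Rightarrow> 'a" where
  "sharp g \<xi> = (THE v. \<forall>x. g v x = blinfun_apply \<xi> x)"

definition dual_product ::
    "('a::euclidean_space \<Rightarrow> 'a \<Rightarrow> real) \<Rightarrow> ('a \<Rightarrow>\<^sub>L real) \<Rightarrow> ('a \<Rightarrow>\<^sub>L real) \<Rightarrow> real" where
  "dual_product g \<xi> \<eta> = g (sharp g \<xi>) (sharp g \<eta>)"

text \<open>Exterior \<open>k\<close>-forms are functions on lists of vectors; only lists of length \<open>k\<close> matter.\<close>

definition alternating_form :: "nat \<Rightarrow> ('a::euclidean_space list \<Rightarrow> real) \<Rightarrow> bool" where
  "alternating_form k \<omega> \<longleftrightarrow>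
     (\<forall>xs i. length xs = k \<and> i < k \<longrightarrow> linear (\<lambda>x. \<omega> (xs[i := x]))) \<and>
     (\<forall>xs i j. length xs = k \<and> i < j \<and> j < k \<and> xs ! i = xs ! j \<longrightarrow> \<omega> xs = 0)"

definition volume_form ::
    "('a::euclidean_space \<Rightarrow> 'a \<Rightarrow> real) \<Rightarrow> ('a list \<Rightarrow> real) \<Rightarrow> bool" where
  "volume_form g vol \<longleftrightarrow> alternating_form DIM('a) vol \<and>
     (\<exists>bs. orthonormal_basis_for g bs \<and> \<bar>vol bs\<bar> = 1)"

definition contract :: "'a \<Rightarrow> ('a list \<Rightarrow> real) \<Rightarrow> 'a list \<Rightarrow> real" where
  "contract x \<omega> = (\<lambda>vs. \<omega> (x # vs))"

definition direction_frame :: "'a::euclidean_space set \<Rightarrow> 'a list \<Rightarrow> bool" where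
  "direction_frame F vs \<longleftrightarrow>
     distinct vs \<and> independent (set vs) \<and> span (set vs) = span {y - x | x y. x \<in> F \<and> y \<in> F}"

text \<open>
  The integral over \<open>F\<close> of the form \<open>\<omega>\<close> with constant coefficients, \<open>F\<close> being oriented by \<open>vs\<close>: in
  the affine chart \<open>t \<mapsto> a + \<Sum> t\<^sub>i v\<^sub>i\<close> the pull-back of \<open>\<omega>\<close> is \<open>\<omega>(v\<^sub>1,\<dots>,v\<^sub>k) dt\<^sub>1\<dots>dt\<^sub>k\<close>.
\<close>

definition integral_constant_form ::
    "'a::euclidean_space set \<Rightarrow> 'a \<Rightarrow> 'a list \<Rightarrow> ('a list \<Rightarrow> real) \<Rightarrow> real" where
  "integral_constant_form F a vs \<omega> =
     (LINT t : {t. a + (\<Sum>i<length vs. t i *\<^sub>R vs ! i) \<in> F} | Pi\<^sub>M {..<length vs} (\<lambda>_. lborel). \<omega> vs)"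

definition outward_vector :: "'a::euclidean_space set \<Rightarrow> 'a set \<Rightarrow> 'a \<Rightarrow> bool" where
  "outward_vector P F u \<longleftrightarrow> (\<exists>x\<in>F. \<exists>y\<in>interior P. u = x - y)"

text \<open>
  The functional \<open>x \<mapsto> \<integral>\<^sub>F \<iota>\<^sub>x vol\<close>. The value does not depend on the choices of \<open>a\<close>, \<open>vs\<close>, \<open>u\<close>. The
  boundary orientation is given by the frames \<open>vs\<close> with \<open>vol(u, vs) > 0\<close> for outward \<open>u\<close>; the sign
  corrects the other frames, and is the orientation of the point \<open>F\<close> when \<open>E\<close> is a line.
\<close>

definition weighted_normal ::
    "('a::euclidean_space list \<Rightarrow> real) \<Rightarrow> 'a set \<Rightarrow> 'a set \<Rightarrow> 'a \<Rightarrow>\<^sub>L real" where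
  "weighted_normal vol P F =
     (let a = (SOME a. a \<in> F);
          vs = (SOME vs. direction_frame F vs);
          u = (SOME u. outward_vector P F u)
      in Blinfun (\<lambda>x. sgn (vol (u # vs)) * integral_constant_form F a vs (contract x vol)))"

definition full_dim_polytope :: "'a::euclidean_space set \<Rightarrow> bool" where
  "full_dim_polytope P \<longleftrightarrow> polytope P \<and> aff_dim P = int DIM('a)"

definition polyhedral_subdivision :: "'a::euclidean_space set \<Rightarrow> 'a set set \<Rightarrow> bool" where
  "polyhedral_subdivision Q \<P> \<longleftrightarrow>
     finite \<P> \<and> (\<forall>P\<in>\<P>. full_dim_polytope P) \<and> \<Union>\<P> = Q \<and>
     (\<forall>P\<in>\<P>. \<forall>P'\<in>\<P>. P \<noteq> P' \<longrightarrow>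
        P \<inter> P' face_of P \<and> P \<inter> P' \<noteq> P \<and> P \<inter> P' face_of P' \<and> P \<inter> P' \<noteq> P')"

definition regular_subdivision :: "'a::euclidean_space set \<Rightarrow> 'a set set \<Rightarrow> bool" where
  "regular_subdivision Q \<P> \<longleftrightarrow>
     (\<exists>(f :: 'a \<Rightarrow> real) (\<xi> :: 'a set \<Rightarrow> 'a \<Rightarrow>\<^sub>L real) (c :: 'a set \<Rightarrow> real).
        continuous_on Q f \<and> convex_on Q f \<and>
        (\<forall>P\<in>\<P>. \<forall>x\<in>P. f x = blinfun_apply (\<xi> P) x + c P) \<and>
        (\<forall>P\<in>\<P>. \<forall>P'\<in>\<P>. \<forall>F. P \<noteq> P' \<and> F facet_of P \<and> F facet_of P' \<longrightarrow>
           (\<xi> P, c P) \<noteq> (\<xi> P', c P')))"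

text \<open>In a graph with legs, \<open>edges\<close> are the non-leg edges.\<close>

record ('v, 'e) legged_graph =
  verts :: "'v set"
  edges :: "'e set"
  legs :: "'e set"
  ends :: "'e \<Rightarrow> 'v set"

definition adjacency :: "('v, 'e) legged_graph \<Rightarrow> ('v \<times> 'v) set" where
  "adjacency G = {(v, w). \<exists>e\<in>edges G. ends G e = {v, w}}"

definition connected_legged_graph :: "('v, 'e) legged_graph \<Rightarrow> bool" where
  "connected_legged_graph G \<longleftrightarrow>
     finite (verts G) \<and> finite (edges G) \<and> finite (legs G) \<and> edges G \<inter> legs G = {} \<and>
     (\<forall>e\<in>edges G. ends G e \<subseteq> verts G \<and> card (ends G e) = 2) \<and>
     (\<forall>l\<in>legs G. ends G l \<subseteq> verts G \<and> card (ends G l) = 1) \<and>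
     verts G \<noteq> {} \<and> (\<forall>v\<in>verts G. \<forall>w\<in>verts G. (v, w) \<in> (adjacency G)\<^sup>*)"

definition dual_graph ::
    "'a::euclidean_space set \<Rightarrow> 'a set set \<Rightarrow> ('a set, 'a set) legged_graph" where
  "dual_graph Q \<P> =
     \<lparr> verts = \<P>,
       edges = {F. \<exists>P\<in>\<P>. \<exists>P'\<in>\<P>. P \<noteq> P' \<and> F facet_of P \<and> F facet_of P'},
       legs = {F. F \<subseteq> frontier Q \<and> (\<exists>P\<in>\<P>. F facet_of P)},
       ends = (\<lambda>F. {P\<in>\<P>. F facet_of P}) \<rparr>"

definition scattering_diagram ::
    "('v, 'e) legged_graph \<Rightarrow> ('v \<Rightarrow> 'e \<Rightarrow> 'w::real_vector) \<Rightarrow> bool" where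
  "scattering_diagram G \<sigma> \<longleftrightarrow> connected_legged_graph G \<and>
     (\<forall>e\<in>edges G. \<forall>v w. ends G e = {v, w} \<and> v \<noteq> w \<longrightarrow> \<sigma> v e = - \<sigma> w e) \<and>
     (\<forall>v\<in>verts G. (\<Sum>e\<in>{e \<in> edges G \<union> legs G. v \<in> ends G e}. \<sigma> v e) = 0)"

definition external_momenta ::
    "('v, 'e) legged_graph \<Rightarrow> ('v \<Rightarrow> 'e \<Rightarrow> 'w) \<Rightarrow> 'e \<Rightarrow> 'w" where
  "external_momenta G \<sigma> l = \<sigma> (THE v. v \<in> ends G l) l"

text \<open>
  The arguments are the graph, the scalar product on momenta, the masses, the external momenta \<open>p\<close>
  and the diagram \<open>\<sigma>\<close> whose intermediate momenta witness that \<open>p\<close> is a real Landau singularity.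
\<close>

definition real_Landau_singularity ::
    "('v, 'e) legged_graph \<Rightarrow> ('w::real_vector \<Rightarrow> 'w \<Rightarrow> real) \<Rightarrow> ('e \<Rightarrow> real) \<Rightarrow>
     ('e \<Rightarrow> 'w) \<Rightarrow> ('v \<Rightarrow> 'e \<Rightarrow> 'w) \<Rightarrow> bool" where
  "real_Landau_singularity G B m p \<sigma> \<longleftrightarrow>
     scattering_diagram G \<sigma> \<and>
     (\<forall>e\<in>edges G \<union> legs G. 0 \<le> m e) \<and>
     (\<forall>l\<in>legs G. p l = external_momenta G \<sigma> l) \<and>
     (\<forall>e\<in>edges G. \<forall>v\<in>ends G e. B (\<sigma> v e) (\<sigma> v e) = (m e)\<^sup>2) \<and>
     (\<exists>(\<alpha> :: 'e \<Rightarrow> real) (\<phi> :: 'v \<Rightarrow> 'w).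
        (\<forall>e\<in>edges G. \<alpha> e > 0) \<and>
        (\<forall>e\<in>edges G. \<forall>v w. ends G e = {v, w} \<and> v \<noteq> w \<longrightarrow>
           \<alpha> e *\<^sub>R \<sigma> v e = \<phi> v - \<phi> w))"

end

theory Submission
  imports Defs
begin

text \<open>
  Momentum conservation at a cell \<open>P\<close> is Minkowski's relation. On a vector \<open>x\<close> leaving \<open>P\<close> through
  \<open>F\<close> the weighted normal takes the value \<open>\<bar>vol\<bar>(F + [0,1]x)\<close>, and \<open>P + [0,1]x\<close> is, up to null sets, the
  disjoint union of \<open>P\<close> and of these prisms. Comparing \<open>P + [0,1]x\<close> with its translate \<open>P - [0,1]x\<close>
  shows that the normals add up to zero. The same formula gives the opposite signs at the two ends of an
  internal facet.

  For the Landau multipliers take \<open>\<phi>(P) = - df|\<^sub>P\<close> for the regularizing function \<open>f\<close>: across an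
  internal facet \<open>df\<close> jumps by a multiple of the conormal of the facet, and convexity of \<open>f\<close> makes the
  multiple positive.
\<close>

section \<open>Integration along a frame\<close>

text \<open>\<open>weighted_normal\<close> is built from chosen points, frames and outward vectors,
  and its integral runs over frame coordinates, whereas Minkowski's relation compares Lebesgue
  volumes of bodies in E. The bridge is that
  \<open>\<bar>\<omega> vs\<bar> * frame_integral vs h z\<close> does not change when
  \<open>vs\<close> is replaced by another basis of its span. This is a change of variables without
  determinants: it needs only that \<omega> is alternating, Tonelli's theorem and affine
  substitutions in one real variable. Comparing the basis of the class with a transversal vector
  followed by a facet frame then expresses the weighted normal through the volume of a prism. Two
  scalar products occur. The one of the class, \<open>\<bullet>\<close>, writes the hyperplanes of
  facets; \<open>g\<close> normalizes the volume form and measures momenta. The relations between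
  neighbouring cells rest on one local fact: from a relative interior point of a facet, a small step
  in any strictly inward direction stays in the cell. It excludes two cells on the same side of a
  facet, keeps shared facets off the boundary of Q, and supplies the points at which convexity of f
  is tested.\<close>

primrec frame_integral :: "'a::euclidean_space list \<Rightarrow> ('a \<Rightarrow> ennreal) \<Rightarrow> 'a \<Rightarrow> ennreal" where
  "frame_integral [] h z = h z"
| "frame_integral (v # vs) h z = (\<integral>\<^sup>+t. frame_integral vs h (z + t *\<^sub>R v) \<partial>lborel)"

lemma frame_integral_measurable [measurable (raw)]:
  assumes h: "h \<in> borel_measurable borel" and g: "g \<in> borel_measurable N"
  shows "(\<lambda>x. frame_integral vs h (g x)) \<in> borel_measurable N"
proof -
  have "frame_integral vs h \<in> borel_measurable borel"
  proof (induction vs)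
    case (Cons v vs)
    note [measurable] = Cons
    have "frame_integral (v # vs) h = (\<lambda>z. \<integral>\<^sup>+t. frame_integral vs h (z + t *\<^sub>R v) \<partial>lborel)"
      by auto
    then show ?case by simp
  qed (use h in simp)
  then show ?thesis
    using g by measurable
qed

lemma frame_integral_swap:
  assumes [measurable]: "h \<in> borel_measurable borel"
  shows "frame_integral (v # w # vs) h z = frame_integral (w # v # vs) h z"
proof -
  have "frame_integral (v # w # vs) h z
      = (\<integral>\<^sup>+t. \<integral>\<^sup>+s. frame_integral vs h (z + t *\<^sub>R v + s *\<^sub>R w) \<partial>lborel \<partial>lborel)"
    by simp
  also have "\<dots> = (\<integral>\<^sup>+s. \<integral>\<^sup>+t. frame_integral vs h (z + t *\<^sub>R v + s *\<^sub>R w) \<partial>lborel \<partial>lborel)"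
    by (rule lborel_pair.Fubini') measurable
  also have "\<dots> = frame_integral (w # v # vs) h z"
    by (simp add: add_ac)
  finally show ?thesis .
qed

text \<open>Adjacent swaps generate all reorderings: \<open>front\<close> carries a vector to the
  head of the list past one neighbour at a time.\<close>

lemma frame_integral_cong_mset:
  assumes [measurable]: "h \<in> borel_measurable borel" and "mset vs = mset ws"
  shows "frame_integral vs h z = frame_integral ws h z"
  using assms(2)
proof (induction vs arbitrary: ws z)
  case (Cons v vs)
  have front: "frame_integral (us1 @ v # us2) h z = frame_integral (v # us1 @ us2) h z"
    for us1 us2 z
  proof (induction us1 arbitrary: z)
    case (Cons u us1)
    have "frame_integral ((u # us1) @ v # us2) h z = frame_integral (u # v # us1 @ us2) h z"
      using Cons by simp
    then show ?case
      by (metis append_Cons assms(1) frame_integral_swap)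
  qed simp
  have "v \<in> set ws"
    using Cons.prems by (metis list.set_intros(1) mset_eq_setD)
  then obtain ws1 ws2 where ws: "ws = ws1 @ v # ws2"
    by (meson split_list)
  then have "mset vs = mset (ws1 @ ws2)"
    using Cons.prems by simp
  from Cons.IH[OF this] show ?case
    unfolding ws front by simp
qed simp

text \<open>It suffices to translate by a multiple of one frame vector. Moved to the outermost
  position, it turns the translation into a shift of one Lebesgue integral over the line.\<close>

lemma frame_integral_translate:
  assumes [measurable]: "h \<in> borel_measurable borel" and "r \<in> span (set vs)"
  shows "frame_integral vs h (z + r) = frame_integral vs h z"
  using assms(2)
proof (induction arbitrary: z rule: span_induct_alt)
  case (step c x y)
  obtain vs1 vs2 where vs: "vs = vs1 @ x # vs2"
    using step.hyps by (meson split_list)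
  have front: "frame_integral vs h z = frame_integral (x # vs1 @ vs2) h z" for z
    by (rule frame_integral_cong_mset) (auto simp: vs)
  have "frame_integral vs h (z + c *\<^sub>R x)
      = (\<integral>\<^sup>+t. frame_integral (vs1 @ vs2) h (z + (c + 1 * t) *\<^sub>R x) \<partial>lborel)"
    unfolding front by (simp add: algebra_simps)
  also have "\<dots> = frame_integral vs h z"
    unfolding front
    using nn_integral_real_affine[of "\<lambda>t. frame_integral (vs1 @ vs2) h (z + t *\<^sub>R x)" 1 c]
    by simp
  finally show ?case
    using step.IH[of "z + c *\<^sub>R x"] by (simp add: add_ac)
qed simp

text \<open>An elementary column operation: the shear \<open>r\<close> disappears by translation
  invariance of the inner integrals, and the scaling is the substitution
  \<open>t \<mapsto> c * t\<close> in the outermost one.\<close>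

lemma frame_integral_replace:
  assumes [measurable]: "h \<in> borel_measurable borel" and "r \<in> span (set vs)" "c \<noteq> 0"
  shows "ennreal \<bar>c\<bar> * frame_integral ((c *\<^sub>R v + r) # vs) h z = frame_integral (v # vs) h z"
proof -
  have "frame_integral vs h (z + t *\<^sub>R (c *\<^sub>R v + r)) = frame_integral vs h (z + (0 + c * t) *\<^sub>R v)" for t
    using frame_integral_translate[OF assms(1) span_scale[OF assms(2)], of "z + (c * t) *\<^sub>R v" t]
    by (simp add: algebra_simps)
  then show ?thesis
    using nn_integral_real_affine[of "\<lambda>t. frame_integral vs h (z + t *\<^sub>R v)" c 0] assms(3)
    by simp
qed

text \<open>Links iterated integrals to product measures, which occur both in
  \<open>integral_constant_form\<close> and in the description of \<open>lborel\<close>. Indices and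
  vectors are kept apart so that one statement serves list positions as well as basis
  vectors.\<close>

lemma frame_integral_eq_PiM:
  assumes [measurable]: "h \<in> borel_measurable borel" and "distinct is"
  shows "frame_integral (map v is) h z =
    (\<integral>\<^sup>+f. h (z + (\<Sum>i\<in>set is. f i *\<^sub>R v i)) \<partial>Pi\<^sub>M (set is) (\<lambda>_. lborel))"
  using assms(2)
proof (induction "is" arbitrary: z)
  case Nil
  then show ?case by (simp add: PiM_empty nn_integral_count_space_finite)
next
  case (Cons j js)
  interpret product_sigma_finite "\<lambda>_. lborel :: real measure" ..
  have *: "(\<Sum>i\<in>insert j (set js). (if i = j then y else f i) *\<^sub>R v i) = y *\<^sub>R v j + (\<Sum>i\<in>set js. f i *\<^sub>R v i)"
    for f :: "'b \<Rightarrow> real" and y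
  proof -
    have "(\<Sum>i\<in>set js. (if i = j then y else f i) *\<^sub>R v i) = (\<Sum>i\<in>set js. f i *\<^sub>R v i)"
      using Cons.prems by (intro sum.cong) auto
    then show ?thesis using Cons.prems by simp
  qed
  have m: "(\<lambda>f. h (z + (\<Sum>i\<in>insert j (set js). f i *\<^sub>R v i)))
      \<in> borel_measurable (Pi\<^sub>M (insert j (set js)) (\<lambda>_. lborel))"
    by measurable
  show ?case
    using Cons
    by (simp add: product_nn_integral_insert_rev[OF _ _ m] * add.assoc del: sum.insert)
qed

text \<open>Independence of the base point is carried along because the outer integral needs the
  inner ones to be constant. The constant function 1 later serves as a test function for the
  non-vanishing of volume forms.\<close>

lemma frame_integral_one_neq_0: "frame_integral vs (\<lambda>_. 1) z \<noteq> 0"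
proof -
  have "\<exists>c. c \<noteq> 0 \<and> (\<forall>z. frame_integral vs (\<lambda>_. 1) z = c)"
  proof (induction vs)
    case (Cons v vs)
    then obtain c where "c \<noteq> 0" "\<And>z. frame_integral vs (\<lambda>_. 1) z = c" by blast
    then show ?case by (intro exI[of _ "c * \<infinity>"]) simp
  qed simp
  then show ?thesis by auto
qed

section \<open>Alternating forms under a change of frame\<close>

lemma alternating_form_swap:
  assumes alt: "alternating_form k \<omega>" and len: "length (us @ x # vs @ y # ws) = k"
  shows "\<bar>\<omega> (us @ x # vs @ y # ws)\<bar> = \<bar>\<omega> (us @ y # vs @ x # ws)\<bar>"
proof -
  define W where "W p q = \<omega> (us @ p # vs @ q # ws)" for p q
  define i j where "i = length us" and "j = Suc (length us + length vs)"
  have ij: "i < j" "j < k"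
    using len by (auto simp: i_def j_def)
  have lin1: "linear (\<lambda>p. W p q)" for q
  proof -
    have "linear (\<lambda>p. \<omega> ((us @ x # vs @ q # ws)[i := p]))"
      using alt len ij unfolding alternating_form_def by simp
    then show ?thesis by (simp add: i_def W_def)
  qed
  have lin2: "linear (\<lambda>q. W p q)" for p
  proof -
    have "linear (\<lambda>q. \<omega> ((us @ p # vs @ y # ws)[j := q]))"
      using alt len ij unfolding alternating_form_def by simp
    then show ?thesis by (simp add: j_def W_def list_update_append)
  qed
  have diag: "W p p = 0" for p
  proof -
    have "(us @ p # vs @ p # ws) ! i = (us @ p # vs @ p # ws) ! j"
      by (simp add: i_def j_def nth_append)
    then show ?thesis
      using alt len ij unfolding alternating_form_def W_def
      by (metis length_append length_Cons)
  qed
  \<comment> \<open>Polarization: the left side and both diagonal terms vanish, so the mixed terms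
    are opposite. Absolute values make it unnecessary to track the sign of a permutation.\<close>
  have "W (x + y) (x + y) = W x x + W x y + W y x + W y y"
    by (simp add: linear_add[OF lin1] linear_add[OF lin2])
  then show ?thesis
    using diag unfolding W_def by (metis abs_minus_cancel add.left_neutral add.right_neutral add_eq_0_iff)
qed

text \<open>The prefix \<open>us\<close> holds the entries already matched; one transposition with
  the head of \<open>ys\<close> brings the next entry into place.\<close>

lemma alternating_form_cong_mset:
  assumes alt: "alternating_form k \<omega>"
  shows "mset xs = mset ys \<Longrightarrow> length (us @ xs) = k \<Longrightarrow> \<bar>\<omega> (us @ xs)\<bar> = \<bar>\<omega> (us @ ys)\<bar>"
proof (induction xs arbitrary: us ys)
  case (Cons x xs)
  have "x \<in> set ys"
    using Cons.prems by (metis list.set_intros(1) mset_eq_setD)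
  then obtain ys1 ys2 where ys: "ys = ys1 @ x # ys2"
    by (meson split_list)
  have len: "length ys = length (x # xs)"
    using Cons.prems(1) by (metis size_mset)
  have "\<exists>zs. mset ys = mset (x # zs) \<and> \<bar>\<omega> (us @ ys)\<bar> = \<bar>\<omega> (us @ x # zs)\<bar>"
  proof (cases ys1)
    case Nil
    then show ?thesis using ys by auto
  next
    case (Cons y ys1')
    have "\<bar>\<omega> (us @ y # ys1' @ x # ys2)\<bar> = \<bar>\<omega> (us @ x # ys1' @ y # ys2)\<bar>"
      by (rule alternating_form_swap[OF alt]) (use Cons.prems(2) len ys Cons in auto)
    then show ?thesis
      using ys Cons by (intro exI[of _ "ys1' @ y # ys2"]) auto
  qed
  then obtain zs where "mset ys = mset (x # zs)" "\<bar>\<omega> (us @ ys)\<bar> = \<bar>\<omega> (us @ x # zs)\<bar>"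
    by blast
  moreover have "\<bar>\<omega> ((us @ [x]) @ xs)\<bar> = \<bar>\<omega> ((us @ [x]) @ zs)\<bar>"
    by (rule Cons.IH) (use Cons.prems calculation in auto)
  ultimately show ?case by simp
qed simp

text \<open>Counterpart of \<open>frame_integral_replace\<close>: by linearity in the first slot,
  adding \<open>r\<close> only adds terms with a repeated vector. The factors \<open>c\<close> of
  the two lemmas cancel in the invariant product.\<close>

lemma alternating_form_replace:
  assumes alt: "alternating_form k \<omega>" and len: "length (v # vs) = k" and r: "r \<in> span (set vs)"
  shows "\<omega> ((c *\<^sub>R v + r) # vs) = c * \<omega> (v # vs)"
proof -
  have "linear (\<lambda>x. \<omega> ((v # vs)[0 := x]))"
    using alt len unfolding alternating_form_def by (metis length_Cons zero_less_Suc)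
  then have lin: "linear (\<lambda>x. \<omega> (x # vs))" by simp
  have "\<omega> (x # vs) = 0" if x: "x \<in> set vs" for x
  proof -
    obtain j where "j < length vs" "vs ! j = x"
      using x by (auto simp: in_set_conv_nth)
    then have "(x # vs) ! 0 = (x # vs) ! Suc j" "Suc j < k" "length (x # vs) = k"
      using len by auto
    then show ?thesis
      using alt unfolding alternating_form_def by blast
  qed
  then have "\<omega> (r # vs) = 0"
    using linear_eq_0_on_span[OF lin _ r] by blast
  then show ?thesis
    by (simp add: linear_add[OF lin] linear_scale[OF lin])
qed

text \<open>Steinitz exchange. Each step moves one vector of the new frame into the common prefix
  \<open>us\<close> and removes one vector of the old frame, by a column operation that leaves the
  product unchanged.\<close>

theorem frame_integral_change_frame:
  assumes alt: "alternating_form k \<omega>" and h: "h \<in> borel_measurable borel"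
    and "length (us @ vs) = k" "length vs = length ws"
    and "distinct (us @ ws)" "independent (set (us @ ws))" "set (us @ ws) \<subseteq> span (set (us @ vs))"
  shows "ennreal \<bar>\<omega> (us @ vs)\<bar> * frame_integral (us @ vs) h z =
    ennreal \<bar>\<omega> (us @ ws)\<bar> * frame_integral (us @ ws) h z"
  using assms(3-)
proof (induction ws arbitrary: us vs)
  case (Cons w ws)
  have wspan: "w \<in> span (set us \<union> set vs)"
    using Cons.prems by auto
  have "w \<notin> span (set us)"
  proof
    assume "w \<in> span (set us)"
    moreover have "set us \<subseteq> set (us @ w # ws) - {w}"
      using Cons.prems by auto
    ultimately have "w \<in> span (set (us @ w # ws) - {w})"
      using span_mono by blast
    then show False
      using Cons.prems by (auto simp: dependent_def)
  qed
  obtain q where q: "w = (\<Sum>b\<in>set us \<union> set vs. q b *\<^sub>R b)"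
    using wspan span_finite[of "set us \<union> set vs"] by auto
  \<comment> \<open>Since \<open>w\<close> lies outside the span of \<open>us\<close>, some old
    vector outside the prefix has a nonzero coefficient; this is the one exchanged for
    \<open>w\<close>.\<close>
  obtain v where v: "v \<in> set vs" "v \<notin> set us" "q v \<noteq> 0"
  proof (rule ccontr)
    assume "\<not> thesis"
    then have "(\<Sum>b\<in>set us \<union> set vs. q b *\<^sub>R b) = (\<Sum>b\<in>set us. q b *\<^sub>R b)"
      using that by (intro sum.mono_neutral_right) auto
    then show False
      using \<open>w \<notin> span (set us)\<close> q by (simp add: span_sum span_scale span_base)
  qed
  obtain vs1 vs2 where vs: "vs = vs1 @ v # vs2"
    using v by (meson split_list)
  define rest where "rest = us @ vs1 @ vs2"
  define r where "r = (\<Sum>b\<in>set us \<union> set vs - {v}. q b *\<^sub>R b)"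
  have wr: "w = q v *\<^sub>R v + r"
    unfolding r_def q using v by (simp add: sum.remove[of _ v])
  have r: "r \<in> span (set rest)"
    unfolding r_def rest_def vs by (intro span_sum span_scale span_base) auto
  have len: "length (v # rest) = k" "length ((us @ [w]) @ vs1 @ vs2) = k"
    using Cons.prems by (auto simp: rest_def vs)
  have ms1: "mset (us @ vs) = mset (v # rest)" and ms2: "mset ((us @ [w]) @ vs1 @ vs2) = mset (w # rest)"
    by (auto simp: rest_def vs)
  \<comment> \<open>Solving for the removed vector shows that the span has not shrunk, so the
    remaining new vectors still lie in the span of the current frame.\<close>
  have "v = (1 / q v) *\<^sub>R w - (1 / q v) *\<^sub>R r"
    unfolding wr using v by (simp add: algebra_simps)
  also have "\<dots> \<in> span (insert w (set rest))"
    using r span_mono[OF subset_insertI, of "set rest" w]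
    by (intro span_diff span_scale) (auto intro: span_base)
  finally have "v \<in> span (insert w (set rest))" .
  then have "set (us @ vs) \<subseteq> span (insert w (set rest))"
    by (auto simp: rest_def vs intro: span_base)
  then have sub: "set (us @ w # ws) \<subseteq> span (insert w (set rest))"
    using Cons.prems(5) span_minimal[OF _ subspace_span] by blast
  have "ennreal \<bar>\<omega> (us @ vs)\<bar> * frame_integral (us @ vs) h z =
      ennreal \<bar>\<omega> (v # rest)\<bar> * frame_integral (v # rest) h z"
    using alternating_form_cong_mset[OF alt ms1, of "[]"] frame_integral_cong_mset[OF h ms1] len
      Cons.prems by simp
  also have "\<dots> = ennreal \<bar>\<omega> (v # rest)\<bar> * (ennreal \<bar>q v\<bar> * frame_integral (w # rest) h z)"
    using frame_integral_replace[OF h r v(3), of v z] wr by simp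
  also have "\<dots> = ennreal \<bar>\<omega> (w # rest)\<bar> * frame_integral (w # rest) h z"
    using alternating_form_replace[OF alt len(1) r, of "q v"] wr
    by (simp add: abs_mult ennreal_mult mult_ac)
  also have "\<dots> = ennreal \<bar>\<omega> ((us @ [w]) @ vs1 @ vs2)\<bar> * frame_integral ((us @ [w]) @ vs1 @ vs2) h z"
    using alternating_form_cong_mset[OF alt ms2, of "[]"] frame_integral_cong_mset[OF h ms2] len by simp
  also have "\<dots> = ennreal \<bar>\<omega> ((us @ [w]) @ ws)\<bar> * frame_integral ((us @ [w]) @ ws) h z"
    by (rule Cons.IH) (use Cons.prems len sub in \<open>auto simp: vs rest_def\<close>)
  finally show ?case by simp
qed simp

section \<open>Volume forms and Lebesgue measure\<close>

lemma volume_form_alternating: "volume_form g vol \<Longrightarrow> alternating_form DIM('a) vol"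
  for vol :: "'a::euclidean_space list \<Rightarrow> real"
  by (simp add: volume_form_def)

text \<open>Applied to the constant function 1, the invariance formula has a nonzero side at the
  orthonormal basis, so \<open>vol vs\<close> cannot vanish on the other side.\<close>

lemma volume_form_nonzero:
  fixes vol :: "'a::euclidean_space list \<Rightarrow> real"
  assumes vol: "volume_form g vol"
    and vs: "distinct vs" "independent (set vs)" "length vs = DIM('a)"
  shows "vol vs \<noteq> 0"
proof
  assume 0: "vol vs = 0"
  obtain bs where bs: "orthonormal_basis_for g bs" "\<bar>vol bs\<bar> = 1"
    using vol by (auto simp: volume_form_def)
  have "set vs \<subseteq> UNIV" "UNIV \<subseteq> span (set vs)"
    using card_ge_dim_independent[of "set vs" UNIV] vs by (auto simp: distinct_card)
  then have "ennreal \<bar>vol ([] @ vs)\<bar> * frame_integral ([] @ vs) (\<lambda>_. 1) 0 =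
    ennreal \<bar>vol ([] @ bs)\<bar> * frame_integral ([] @ bs) (\<lambda>_. 1) 0"
    using bs vs
    by (intro frame_integral_change_frame[OF volume_form_alternating[OF vol]])
      (auto simp: orthonormal_basis_for_def)
  then show False
    using 0 bs(2) frame_integral_one_neq_0[of bs 0] by simp
qed

text \<open>The reference frame for \<open>lborel\<close>. \<open>Basis\<close> is orthonormal for
  the inner product of the class and not necessarily for \<open>g\<close>, so
  \<open>\<bar>vol basis_list\<bar>\<close> need not be 1; it is the density of
  \<open>\<bar>vol\<bar>\<close> with respect to Lebesgue measure.\<close>

definition basis_list :: "'a::euclidean_space list" where
  "basis_list = (SOME bs. set bs = Basis \<and> distinct bs)"

lemma basis_list: "set (basis_list :: 'a list) = (Basis :: 'a::euclidean_space set)"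
  "distinct (basis_list :: 'a list)" "length (basis_list :: 'a list) = DIM('a)"
proof -
  have "\<exists>bs. set bs = (Basis :: 'a set) \<and> distinct bs"
    using finite_distinct_list[OF finite_Basis] by blast
  then show *: "set (basis_list :: 'a list) = Basis" "distinct (basis_list :: 'a list)"
    unfolding basis_list_def by (metis (mono_tags, lifting) someI_ex)+
  show "length (basis_list :: 'a list) = DIM('a)"
    using * by (metis distinct_card)
qed

lemma frame_integral_basis_list:
  fixes h :: "'a::euclidean_space \<Rightarrow> ennreal"
  assumes [measurable]: "h \<in> borel_measurable borel"
  shows "frame_integral basis_list h 0 = (\<integral>\<^sup>+x. h x \<partial>lborel)"
proof -
  have "frame_integral (map id basis_list) h 0
      = (\<integral>\<^sup>+f. h (\<Sum>i\<in>Basis. f i *\<^sub>R i) \<partial>Pi\<^sub>M (Basis :: 'a set) (\<lambda>_. lborel))"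
    by (subst frame_integral_eq_PiM) (simp_all add: basis_list)
  also have "\<dots> = (\<integral>\<^sup>+x. h x \<partial>lborel)"
    by (subst (2) lborel_eq) (subst nn_integral_distr, auto)
  finally show ?thesis by simp
qed

lemma frame_integral_eq_lborel:
  fixes h :: "'a::euclidean_space \<Rightarrow> ennreal"
  assumes alt: "alternating_form DIM('a) vol"
    and vs: "distinct vs" "independent (set vs)" "length vs = DIM('a)"
    and h: "h \<in> borel_measurable borel"
  shows "ennreal \<bar>vol vs\<bar> * frame_integral vs h 0 =
    ennreal \<bar>vol basis_list\<bar> * (\<integral>\<^sup>+x. h x \<partial>lborel)"
  using frame_integral_change_frame[OF alt h, of "[]" basis_list vs 0] vs
  by (simp add: basis_list frame_integral_basis_list h)

section \<open>Prisms over a facet\<close>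

definition sweep :: "'a::real_vector set \<Rightarrow> 'a \<Rightarrow> 'a set" where
  "sweep S x = {y + t *\<^sub>R x |y t. y \<in> S \<and> 0 \<le> t \<and> t \<le> 1}"

lemma sweep_eq_image: "sweep S x = (\<lambda>(y, t). y + t *\<^sub>R x) ` (S \<times> {0..1})"
  unfolding sweep_def by force

lemma compact_sweep: "compact S \<Longrightarrow> compact (sweep S x)"
  for S :: "'a::euclidean_space set"
  unfolding sweep_eq_image
  by (intro compact_continuous_image compact_Times)
    (auto simp: case_prod_beta intro!: continuous_intros)

text \<open>Fubini along a frame of the facet extended by \<open>x\<close>.\<close>

lemma frame_integral_sweep:
  fixes F :: "'a::euclidean_space set"
  assumes alt: "alternating_form DIM('a) vol"
    and frame: "distinct (x # vs)" "independent (set (x # vs))" "length (x # vs) = DIM('a)"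
    and F: "compact F" and a: "a \<in> F" and dir: "\<And>y. y \<in> F \<Longrightarrow> y - a \<in> span (set vs)"
  shows "ennreal \<bar>vol (x # vs)\<bar> * frame_integral vs (\<lambda>y. indicator F (a + y)) 0 =
    ennreal \<bar>vol basis_list\<bar> * emeasure lborel (sweep F x)"
proof -
  let ?S = "sweep F x"
  have [measurable]: "?S \<in> sets borel" "F \<in> sets borel"
    using F compact_sweep[OF F] by (auto intro: borel_compact)
  define h where "h = (\<lambda>y. indicator ?S (a + y) :: ennreal)"
  have hm: "h \<in> borel_measurable borel"
    unfolding h_def by measurable
  have xs: "x \<notin> span (set vs)"
    using frame by (auto simp: dependent_def)
  \<comment> \<open>Inside the facet directions the indicator of the prism factors into a height
    condition on \<open>t\<close> and membership in \<open>F\<close>. The induction needs arbitrary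
    lists \<open>us\<close> and base points \<open>z\<close> in the span of
    \<open>vs\<close>.\<close>
  have val: "frame_integral us h (t *\<^sub>R x + z) =
      indicator {0..1} t * frame_integral us (\<lambda>y. indicator F (a + y)) z"
    if "set us \<subseteq> span (set vs)" "z \<in> span (set vs)" for us t z
    using that
  proof (induction us arbitrary: z)
    case Nil
    have "a + (t *\<^sub>R x + z) \<in> ?S \<longleftrightarrow> t \<in> {0..1} \<and> a + z \<in> F"
    proof
      assume "a + (t *\<^sub>R x + z) \<in> ?S"
      then obtain y s where ys: "a + (t *\<^sub>R x + z) = y + s *\<^sub>R x" "y \<in> F" "0 \<le> s" "s \<le> 1"
        by (auto simp: sweep_def)
      then have "(t - s) *\<^sub>R x = (y - a) - z"
        by (simp add: algebra_simps)
      then have "(t - s) *\<^sub>R x \<in> span (set vs)"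
        using dir[OF ys(2)] Nil by (simp add: span_diff)
      \<comment> \<open>Transversality of \<open>x\<close> makes the height of a point of the prism
        unique.\<close>
      then have "t = s"
        using xs span_scale[of "(t - s) *\<^sub>R x" "set vs" "1 / (t - s)"] by (cases "t = s") auto
      then show "t \<in> {0..1} \<and> a + z \<in> F"
        using ys by (auto simp: algebra_simps)
    next
      assume "t \<in> {0..1} \<and> a + z \<in> F"
      then show "a + (t *\<^sub>R x + z) \<in> ?S"
        unfolding sweep_def by (force simp: algebra_simps)
    qed
    then show ?case
      by (auto simp: h_def indicator_def)
  next
    case (Cons u us)
    have "z + s *\<^sub>R u \<in> span (set vs)" for s
      using Cons.prems by (auto intro: span_add span_scale)
    then have "frame_integral (u # us) h (t *\<^sub>R x + z) = (\<integral>\<^sup>+s. indicator {0..1} t *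
        frame_integral us (\<lambda>y. indicator F (a + y)) (z + s *\<^sub>R u) \<partial>lborel)"
      using Cons by (simp add: add.assoc)
    then show ?case
      by (simp add: nn_integral_cmult)
  qed
  have "frame_integral (x # vs) h 0 =
      (\<integral>\<^sup>+t. indicator {0..1} (t::real) * frame_integral vs (\<lambda>y. indicator F (a + y)) 0 \<partial>lborel)"
    using val[of vs 0] by (simp add: span_superset span_zero)
  also have "\<dots> = frame_integral vs (\<lambda>y. indicator F (a + y)) 0"
    by (simp add: nn_integral_multc)
  finally have "ennreal \<bar>vol (x # vs)\<bar> * frame_integral vs (\<lambda>y. indicator F (a + y)) 0 =
    ennreal \<bar>vol basis_list\<bar> * (\<integral>\<^sup>+y. h y \<partial>lborel)"
    using frame_integral_eq_lborel[OF alt frame hm] by simp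
  also have "(\<integral>\<^sup>+y. h y \<partial>lborel) = (\<integral>\<^sup>+y. indicator ?S y \<partial>distr lborel borel ((+) a))"
    unfolding h_def by (subst nn_integral_distr) auto
  also have "\<dots> = emeasure lborel ?S"
    unfolding lborel_distr_plus by simp
  finally show ?thesis .
qed

text \<open>No finiteness is required: a non-integrable function has Bochner integral 0, and
  \<open>enn2real\<close> of infinity is 0 as well. That the value is finite for facets is shown in
  \<open>weighted_normal_eq\<close>.\<close>

lemma integral_constant_form_eq:
  fixes F :: "'a::euclidean_space set"
  assumes F: "closed F"
  shows "integral_constant_form F a vs \<omega> =
    enn2real (frame_integral vs (\<lambda>y. indicator F (a + y)) 0) * \<omega> vs"
proof -
  let ?M = "Pi\<^sub>M {..<length vs} (\<lambda>_. lborel :: real measure)"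
  let ?c = "\<lambda>t. a + (\<Sum>i<length vs. t i *\<^sub>R vs ! i)"
  have [measurable]: "F \<in> sets borel"
    using F by simp
  have "frame_integral (map ((!) vs) [0..<length vs]) (\<lambda>y. indicator F (a + y)) 0 =
      (\<integral>\<^sup>+t. indicator F (?c t) \<partial>?M)"
    by (subst frame_integral_eq_PiM) (auto simp: atLeast0LessThan)
  then have "frame_integral vs (\<lambda>y. indicator F (a + y)) 0 = (\<integral>\<^sup>+t. indicator F (?c t) \<partial>?M)"
    by (simp add: map_nth)
  then have "enn2real (frame_integral vs (\<lambda>y. indicator F (a + y)) 0) = (\<integral>t. indicator F (?c t) \<partial>?M)"
    by (subst integral_eq_nn_integral) (auto simp flip: ennreal_indicator)
  then show ?thesis
    unfolding integral_constant_form_def set_lebesgue_integral_def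
    by (simp add: indicator_def of_bool_def)
qed

section \<open>Facets and weighted normals\<close>

text \<open>\<open>a\<close> is a normal for the inner product of the class, so
  \<open>\<lambda>x. a \<bullet> x\<close> is an outward conormal of the facet. Its length is left
  free.\<close>

definition facet_normal :: "'a::euclidean_space set \<Rightarrow> 'a set \<Rightarrow> 'a \<Rightarrow> real \<Rightarrow> bool" where
  "facet_normal P F a b \<longleftrightarrow>
     a \<noteq> 0 \<and> (\<forall>x\<in>P. a \<bullet> x \<le> b) \<and> F = P \<inter> {x. a \<bullet> x = b} \<and> F facet_of P"

lemma facet_normal_exists:
  assumes "full_dim_polytope P" "F facet_of P"
  obtains a b where "facet_normal P F a b"
proof -
  have "polyhedron P"
    using assms by (simp add: full_dim_polytope_def polytope_imp_polyhedron)
  then obtain a b where "a \<noteq> 0" "P \<subseteq> {x. a \<bullet> x \<le> b}" "F = P \<inter> {x. a \<bullet> x = b}"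
    using facet_of_polyhedron assms(2) by metis
  then show ?thesis
    using assms(2) that unfolding facet_normal_def by auto
qed

lemma facet_aff_dim:
  fixes P :: "'a::euclidean_space set"
  assumes P: "full_dim_polytope P" and F: "F facet_of P"
  shows "aff_dim F = int DIM('a) - 1" "F \<noteq> {}" "F \<noteq> P" "convex F" "compact F"
proof -
  have "convex P" "compact P" "aff_dim P = int DIM('a)"
    using P by (auto simp: full_dim_polytope_def polytope_imp_convex polytope_imp_compact)
  moreover have "F face_of P" "F \<noteq> {}" "aff_dim F = aff_dim P - 1"
    using F unfolding facet_of_def by blast+
  ultimately show "aff_dim F = int DIM('a) - 1" "F \<noteq> {}" "F \<noteq> P" "convex F" "compact F"
    using face_of_imp_compact face_of_imp_convex by (simp, blast, force, blast, blast)
qed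

lemma affine_hull_facet:
  fixes F :: "'a::euclidean_space set"
  assumes "aff_dim F = int DIM('a) - 1" "F \<noteq> {}" "F \<subseteq> {x. a \<bullet> x = b}" "a \<noteq> 0"
  shows "affine hull F = {x. a \<bullet> x = b}"
proof (rule affine_dim_equal)
  show "affine hull F \<subseteq> {x. a \<bullet> x = b}"
    by (intro hull_minimal assms(3) affine_hyperplane)
  show "aff_dim (affine hull F) = aff_dim {x. a \<bullet> x = b}"
    using assms(1,4) by simp
qed (use assms(2) in \<open>simp_all add: affine_hyperplane\<close>)

text \<open>Identifies the span of every direction frame of \<open>F\<close> with the kernel of the
  conormal, so that nothing later depends on which frame was chosen. It rests on a dimension count:
  the affine hull of \<open>F\<close> is the whole hyperplane.\<close>

lemma span_facet_directions:
  fixes F :: "'a::euclidean_space set"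
  assumes "aff_dim F = int DIM('a) - 1" "F \<noteq> {}" "F \<subseteq> {x. a \<bullet> x = b}" "a \<noteq> 0"
  shows "span {y - x |x y. x \<in> F \<and> y \<in> F} = {d. a \<bullet> d = 0}"
proof (intro antisym subsetI)
  fix d assume "d \<in> span {y - x |x y. x \<in> F \<and> y \<in> F}"
  then show "d \<in> {d. a \<bullet> d = 0}"
  proof (rule span_induct)
    show "subspace {d. d \<in> {d. a \<bullet> d = 0}}"
      by (simp add: subspace_hyperplane)
    show "x \<in> {d. a \<bullet> d = 0}" if x: "x \<in> {y - x |x y. x \<in> F \<and> y \<in> F}" for x
    proof -
      obtain y z where "x = y - z" "y \<in> F" "z \<in> F"
        using x by blast
      moreover from this have "a \<bullet> y = b" "a \<bullet> z = b"
        using assms(3) by blast+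
      ultimately show ?thesis
        by (simp add: inner_diff_right)
    qed
  qed
next
  fix d assume "d \<in> {d. a \<bullet> d = 0}"
  obtain f where f: "f \<in> F" using assms by auto
  have "f + d \<in> affine hull F"
    using affine_hull_facet[OF assms] f assms \<open>d \<in> _\<close> by (auto simp: inner_add_right)
  then have "d \<in> span {x - f |x. x \<in> F - {f}}"
    unfolding affine_hull_span[OF f] by auto
  then show "d \<in> span {y - x |x y. x \<in> F \<and> y \<in> F}"
    using span_mono[of "{x - f |x. x \<in> F - {f}}" "{y - x |x y. x \<in> F \<and> y \<in> F}"] f by blast
qed

text \<open>Both normals have the facet directions as kernel. The component \<open>d\<close> of
  \<open>a'\<close> orthogonal to \<open>a\<close> lies in that kernel, hence is orthogonal to
  itself.\<close>

lemma facet_normal_unique: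
  fixes F :: "'a::euclidean_space set"
  assumes "aff_dim F = int DIM('a) - 1" "F \<noteq> {}"
    and "F \<subseteq> {x. a \<bullet> x = b}" "a \<noteq> 0" "F \<subseteq> {x. a' \<bullet> x = b'}" "a' \<noteq> 0"
  obtains c where "c \<noteq> 0" "a' = c *\<^sub>R a" "b' = c * b"
proof
  define c where "c = (a' \<bullet> a) / (a \<bullet> a)"
  define d where "d = a' - c *\<^sub>R a"
  have "a \<bullet> d = 0"
    using assms by (simp add: d_def c_def inner_diff_right inner_commute)
  moreover have "{d. a \<bullet> d = 0} = {d. a' \<bullet> d = 0}"
    using span_facet_directions[OF assms(1-4)] span_facet_directions[OF assms(1,2,5,6)] by simp
  ultimately have "a' \<bullet> d = 0" by auto
  with \<open>a \<bullet> d = 0\<close> have "d \<bullet> d = 0"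
    by (simp add: d_def inner_diff_left)
  then show *: "a' = c *\<^sub>R a"
    by (simp add: d_def)
  then show "c \<noteq> 0"
    using assms by auto
  obtain f where "f \<in> F" using assms by auto
  then show "b' = c * b"
    using assms * by auto
qed

lemma direction_frame_exists: "\<exists>vs. direction_frame F vs"
proof -
  define D where "D = {y - x |x y. x \<in> F \<and> y \<in> F}"
  obtain B where B: "B \<subseteq> D" "independent B" "D \<subseteq> span B"
    using maximal_independent_subset[of D] by metis
  then have "span B = span D"
    by (meson order_antisym span_minimal span_mono subspace_span)
  moreover obtain vs where "set vs = B" "distinct vs"
    using finite_distinct_list[OF finiteI_independent[OF B(2)]] by blast
  ultimately show ?thesis
    using B(2) unfolding direction_frame_def D_def by blast
qed

lemma interior_halfspace_lt:
  assumes "\<forall>x\<in>P. a \<bullet> x \<le> b" "a \<noteq> 0" "y \<in> interior P"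
  shows "a \<bullet> y < b"
proof -
  have "interior P \<subseteq> interior {x. a \<bullet> x \<le> b}"
    using assms by (intro interior_mono) auto
  then show ?thesis
    using assms by (auto simp: interior_halfspace_le)
qed

lemma full_dim_interior_nonempty:
  assumes "full_dim_polytope P"
  shows "interior P \<noteq> {}"
  using assms rel_interior_eq_empty[of P] interior_rel_interior_gen[of P]
  by (auto simp: full_dim_polytope_def polytope_imp_convex)

text \<open>The prism is convex and contains both \<open>F\<close> and a point off the hyperplane of
  \<open>F\<close>, so it is full-dimensional and has interior. This is what makes weighted normals
  nonzero.\<close>

lemma sweep_facet_not_negligible:
  fixes F :: "'a::euclidean_space set"
  assumes "aff_dim F = int DIM('a) - 1" "F \<noteq> {}" "convex F"
    and "F \<subseteq> {y. a \<bullet> y = b}" "a \<bullet> x \<noteq> 0"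
  shows "\<not> negligible (sweep F x)"
proof -
  have "sweep F x = (\<Union>y\<in>F. \<Union>z\<in>(\<lambda>t. t *\<^sub>R x) ` {0..1}. {y + z})"
    unfolding sweep_eq_image by auto
  moreover have "convex ((\<lambda>t. t *\<^sub>R x) ` {0..1::real})"
    by (intro convex_linear_image convex_real_interval) (auto intro: linearI simp: algebra_simps)
  ultimately have conv: "convex (sweep F x)"
    using convex_sums[OF \<open>convex F\<close>] by metis
  have sub: "F \<subseteq> sweep F x"
    unfolding sweep_def by force
  have "aff_dim F \<noteq> aff_dim (sweep F x)"
  proof
    assume "aff_dim F = aff_dim (sweep F x)"
    then have "affine hull F = affine hull (sweep F x)"
      using aff_dim_eq_full_gen[OF sub] by simp
    moreover obtain f where f: "f \<in> F" using assms by auto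
    moreover have "f + x \<in> sweep F x"
      unfolding sweep_eq_image by (rule image_eqI[of _ _ "(f, 1)"]) (use f in auto)
    moreover have "affine hull F \<subseteq> {y. a \<bullet> y = b}"
      by (intro hull_minimal assms affine_hyperplane)
    ultimately have "a \<bullet> (f + x) = b" "a \<bullet> f = b"
      using hull_inc[of "f + x" "sweep F x" affine] assms by auto
    then show False
      using assms by (simp add: inner_add_right)
  qed
  then have "aff_dim (sweep F x) = DIM('a)"
    using aff_dim_subset[OF sub] aff_dim_le_DIM[of "sweep F x"] assms by linarith
  then have "interior (sweep F x) \<noteq> {}"
    using rel_interior_eq_empty[OF conv] interior_rel_interior_gen[of "sweep F x"] sub assms(2)
    by auto
  then show ?thesis
    using negligible_convex_interior[OF conv] by simp
qed

text \<open>Removes all choices from the definition. The second clause determines \<open>K\<close>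
  by volumes of prisms over \<open>F\<close> alone; the cell enters only through the side to which
  \<open>a\<close> points, which makes normals of neighbouring cells comparable.\<close>

theorem weighted_normal_eq:
  fixes P :: "'a::euclidean_space set"
  assumes vol: "volume_form g vol" and P: "full_dim_polytope P" and n: "facet_normal P F a b"
  shows "\<exists>K>0. (\<forall>x. blinfun_apply (weighted_normal vol P F) x = K * (a \<bullet> x)) \<and>
    (\<forall>x. a \<bullet> x > 0 \<longrightarrow> K * (a \<bullet> x) = \<bar>vol basis_list\<bar> * measure lebesgue (sweep F x))"
proof -
  have F: "F facet_of P" "F \<subseteq> {x. a \<bullet> x = b}" "a \<noteq> 0" "F \<subseteq> P" "\<forall>x\<in>P. a \<bullet> x \<le> b"
    using n unfolding facet_normal_def by blast+
  note facet = facet_aff_dim[OF P F(1)]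
  note alt = volume_form_alternating[OF vol]
  define p where "p = (SOME a. a \<in> F)"
  define vs where "vs = (SOME vs. direction_frame F vs)"
  define u where "u = (SOME u. outward_vector P F u)"
  have p: "p \<in> F"
    unfolding p_def using facet(2) by (simp add: some_in_eq)
  have "direction_frame F vs"
    unfolding vs_def using direction_frame_exists by (rule someI_ex)
  then have vs: "distinct vs" "independent (set vs)" "span (set vs) = {d. a \<bullet> d = 0}"
    unfolding direction_frame_def span_facet_directions[OF facet(1,2) F(2,3)] by blast+
  have "\<exists>u. outward_vector P F u"
    using p full_dim_interior_nonempty[OF P] unfolding outward_vector_def by blast
  then have "outward_vector P F u"
    unfolding u_def by (rule someI_ex)
  then have u: "a \<bullet> u > 0"
    using F interior_halfspace_lt[OF F(5,3)] unfolding outward_vector_def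
    by (auto simp: inner_diff_right)
  have "length vs = dim (span (set vs))"
    using vs(1,2) by (simp add: distinct_card dim_eq_card_independent)
  then have len: "Suc (length vs) = DIM('a)"
    unfolding vs(3) using dim_hyperplane[OF F(3)] DIM_positive[where 'a='a] by simp
  have frame: "distinct (x # vs)" "independent (set (x # vs))" "length (x # vs) = DIM('a)"
    if "a \<bullet> x \<noteq> 0" for x
  proof -
    have "x \<notin> span (set vs)"
      using that vs by simp
    then show "distinct (x # vs)" "independent (set (x # vs))" "length (x # vs) = DIM('a)"
      using vs len span_base by (auto simp: independent_insert)
  qed
  \<comment> \<open>With \<open>vs\<close> fixed, \<open>vol (x # vs)\<close> is a linear functional
    of \<open>x\<close> vanishing on the kernel of \<open>a\<close>, hence a multiple of
    \<open>a \<bullet> x\<close>; the factor is read off at \<open>x = a\<close>.\<close>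
  define c where "c = vol (a # vs) / (a \<bullet> a)"
  have aa: "a \<bullet> a > 0"
    using F by simp
  have lin: "vol (x # vs) = c * (a \<bullet> x)" for x
  proof -
    define t where "t = (a \<bullet> x) / (a \<bullet> a)"
    have "x - t *\<^sub>R a \<in> span (set vs)"
      using aa unfolding vs(3) t_def by (simp add: inner_diff_right)
    then have "vol ((t *\<^sub>R a + (x - t *\<^sub>R a)) # vs) = t * vol (a # vs)"
      using len by (intro alternating_form_replace[OF alt]) auto
    then show ?thesis
      by (simp add: t_def c_def)
  qed
  have "c \<noteq> 0"
    using volume_form_nonzero[OF vol frame[of a]] lin[of a] aa by auto
  define I where "I = frame_integral vs (\<lambda>y. indicator F (p + y)) 0"
  have dir: "y - p \<in> span (set vs)" if "y \<in> F" for y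
    using that p F unfolding vs(3) by (auto simp: inner_diff_right)
  have sw: "ennreal \<bar>c * (a \<bullet> x)\<bar> * I = ennreal \<bar>vol basis_list\<bar> * ennreal (measure lebesgue (sweep F x))"
    if "a \<bullet> x \<noteq> 0" for x
  proof -
    have "compact (sweep F x)"
      by (simp add: compact_sweep facet)
    then have "emeasure lborel (sweep F x) = ennreal (measure lebesgue (sweep F x))"
      using emeasure_compact_finite[of "sweep F x"] borel_compact[of "sweep F x"]
      by (simp add: emeasure_eq_ennreal_measure)
    then show ?thesis
      using frame_integral_sweep[OF alt frame[OF that] facet(5) p dir] lin by (simp add: I_def)
  qed
  have "vol basis_list \<noteq> 0"
    by (rule volume_form_nonzero[OF vol]) (simp_all add: basis_list independent_Basis)
  \<comment> \<open>An infinite facet integral would give infinite volume to the compact prism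
    \<open>sweep F a\<close>.\<close>
  have "I < \<infinity>"
  proof (rule ccontr)
    assume "\<not> I < \<infinity>"
    then have "I = \<infinity>" by (cases I) (auto simp: ennreal_less_top)
    then have "ennreal \<bar>vol basis_list\<bar> * ennreal (measure lebesgue (sweep F a)) = \<infinity>"
      using sw[of a] aa \<open>c \<noteq> 0\<close> by (simp add: ennreal_mult_top)
    then show False
      by (simp add: ennreal_mult_eq_top_iff)
  qed
  then obtain L where L: "I = ennreal L" "L \<ge> 0"
    by (cases I) auto
  define K where "K = \<bar>c\<bar> * L"
  have eq: "K * (a \<bullet> x) = \<bar>vol basis_list\<bar> * measure lebesgue (sweep F x)" if "a \<bullet> x > 0" for x
    using sw[of x] that L by (simp add: K_def abs_mult mult_ac flip: ennreal_mult)
  have "measure lebesgue (sweep F a) > 0"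
    using sweep_facet_not_negligible[OF facet(1,2,4) F(2), of a] aa
      negligible_iff_measure0[OF lmeasurable_compact[OF compact_sweep[OF facet(5)]], of a]
    by (simp add: zero_less_measure_iff)
  then have "K * (a \<bullet> a) > 0"
    using eq[of a] aa \<open>vol basis_list \<noteq> 0\<close> by simp
  then have "K > 0"
    using aa by (simp add: zero_less_mult_iff)
  moreover have "blinfun_apply (weighted_normal vol P F) x = K * (a \<bullet> x)" for x
  proof -
    have fin: "closed F"
      using facet(5) by (rule compact_imp_closed)
    have "sgn (vol (u # vs)) * integral_constant_form F p vs (contract x vol) = K * (a \<bullet> x)" for x
    proof -
      \<comment> \<open>Because \<open>u\<close> points outward, the orientation sign is
        \<open>sgn c\<close>; multiplied by \<open>c\<close> it gives \<open>\<bar>c\<bar>\<close>,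
        whatever the orientation of \<open>vs\<close> or of \<open>vol\<close>.\<close>
      have "sgn (vol (u # vs)) * integral_constant_form F p vs (contract x vol)
          = sgn (c * (a \<bullet> u)) * (L * (c * (a \<bullet> x)))"
        unfolding integral_constant_form_eq[OF fin] I_def[symmetric] L contract_def lin
        using L by simp
      also have "\<dots> = K * (a \<bullet> x)"
        using u by (simp add: sgn_mult K_def abs_sgn[of c] mult_ac)
      finally show ?thesis .
    qed
    then have "weighted_normal vol P F = Blinfun (\<lambda>x. K * (a \<bullet> x))"
      unfolding weighted_normal_def Let_def p_def[symmetric] vs_def[symmetric] u_def[symmetric]
      by simp
    moreover have "bounded_linear (\<lambda>x. K * (a \<bullet> x))"
      by (intro bounded_linear_intros)
    ultimately show ?thesis
      by (simp add: bounded_linear_Blinfun_apply)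
  qed
  ultimately show ?thesis
    using eq by blast
qed

section \<open>The Minkowski relation\<close>

text \<open>An interior point of \<open>P\<close> satisfies both strict inequalities, which fixes
  the sign of the proportionality factor.\<close>

lemma facet_normal_unique_pos:
  fixes P :: "'a::euclidean_space set"
  assumes P: "full_dim_polytope P" and n: "facet_normal P F a b" and n': "facet_normal P F a' b'"
  obtains c where "c > 0" "a' = c *\<^sub>R a" "b' = c * b"
proof -
  have F: "F facet_of P" and sub: "F \<subseteq> {x. a \<bullet> x = b}" "a \<noteq> 0" "F \<subseteq> {x. a' \<bullet> x = b'}" "a' \<noteq> 0"
    using n n' unfolding facet_normal_def by blast+
  obtain c where c: "c \<noteq> 0" "a' = c *\<^sub>R a" "b' = c * b"
    using facet_normal_unique[OF facet_aff_dim(1,2)[OF P F] sub] by metis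
  obtain y where y: "y \<in> interior P"
    using full_dim_interior_nonempty[OF P] by blast
  have lt: "a \<bullet> y < b" "a' \<bullet> y < b'"
    using interior_halfspace_lt[OF _ _ y] n n' unfolding facet_normal_def by blast+
  have "c * (a \<bullet> y) < c * b"
    using lt(2) c by simp
  then have "c > 0"
    using lt(1) c(1) mult_less_cancel_left_neg[of c "a \<bullet> y" b] by linarith
  then show ?thesis
    using c that by blast
qed

text \<open>In a minimal description of a polyhedron by halfspaces every halfspace cuts out a facet.
  Full dimension makes the affine hull the whole space, so a point outside \<open>P\<close> violates
  one of these halfspaces.\<close>

lemma facet_separates:
  fixes P :: "'a::euclidean_space set"
  assumes P: "full_dim_polytope P" and z: "z \<notin> P"
  obtains F a b where "facet_normal P F a b" "a \<bullet> z > b"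
proof -
  have "polyhedron P"
    using P by (simp add: full_dim_polytope_def polytope_imp_polyhedron)
  then obtain H where H: "finite H" and seq: "P = affine hull P \<inter> \<Inter>H"
      and faces: "\<And>h. h \<in> H \<Longrightarrow> \<exists>a b. a \<noteq> 0 \<and> h = {x. a \<bullet> x \<le> b}"
      and min: "\<And>H'. H' \<subset> H \<Longrightarrow> P \<subset> (affine hull P) \<inter> \<Inter>H'"
    by (simp add: polyhedron_Int_affine_minimal) meson
  obtain a b where ab: "\<And>h. h \<in> H \<Longrightarrow> a h \<noteq> 0 \<and> h = {x. a h \<bullet> x \<le> b h}"
    using faces by metis
  have "affine hull P = UNIV"
    using P by (simp add: full_dim_polytope_def aff_dim_eq_full)
  then have PH: "P = \<Inter>H" using seq by simp
  then obtain h where h: "h \<in> H" "z \<notin> h"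
    using z by blast
  have "(P \<inter> {x. a h \<bullet> x = b h}) facet_of P"
    using facet_of_polyhedron_explicit[OF H seq ab min] h(1) by blast
  moreover have "P \<subseteq> h" using PH h(1) by blast
  ultimately have "facet_normal P (P \<inter> {x. a h \<bullet> x = b h}) (a h) (b h)"
    using ab[OF h(1)] unfolding facet_normal_def by blast
  moreover have "a h \<bullet> z > b h"
    using ab[OF h(1)] h(2) by force
  ultimately show ?thesis using that by blast
qed

text \<open>A separating facet normal is a positive multiple of the one selected for that facet, so
  the selected inequalities still cut out \<open>P\<close>.\<close>

lemma facet_normals_exist:
  fixes P :: "'a::euclidean_space set"
  assumes P: "full_dim_polytope P"
  obtains a b where "\<And>F. F facet_of P \<Longrightarrow> facet_normal P F (a F) (b F)"
    "\<And>z. (\<And>F. F facet_of P \<Longrightarrow> a F \<bullet> z \<le> b F) \<Longrightarrow> z \<in> P"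
proof -
  have "\<exists>a b. facet_normal P F a b" if "F facet_of P" for F
    using facet_normal_exists[OF P that] by blast
  then have "\<exists>a b. \<forall>F. F facet_of P \<longrightarrow> facet_normal P F (a F) (b F)"
    by metis
  then obtain a b where ab: "\<And>F. F facet_of P \<Longrightarrow> facet_normal P F (a F) (b F)"
    by blast
  moreover have "z \<in> P" if z: "\<And>F. F facet_of P \<Longrightarrow> a F \<bullet> z \<le> b F" for z
  proof (rule ccontr)
    assume "z \<notin> P"
    then obtain F a' b' where F: "facet_normal P F a' b'" "a' \<bullet> z > b'"
      using facet_separates[OF P] by blast
    then have facet: "F facet_of P"
      unfolding facet_normal_def by blast
    obtain c where "c > 0" "a' = c *\<^sub>R a F" "b' = c * b F"
      using facet_normal_unique_pos[OF P ab[OF facet] F(1)] by blast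
    then show False
      using F(2) z[OF facet] by simp
  qed
  ultimately show ?thesis using that by blast
qed

lemma finite_facets: "full_dim_polytope P \<Longrightarrow> finite {F. F facet_of P}"
  by (simp add: finite_polyhedron_facets full_dim_polytope_def polytope_imp_polyhedron)

lemma compact_full_dim: "full_dim_polytope P \<Longrightarrow> compact P"
  by (simp add: full_dim_polytope_def polytope_imp_compact)

lemma convex_full_dim: "full_dim_polytope P \<Longrightarrow> convex P"
  by (simp add: full_dim_polytope_def polytope_imp_convex)

lemma sweepI: "y \<in> S \<Longrightarrow> 0 \<le> t \<Longrightarrow> t \<le> 1 \<Longrightarrow> y + t *\<^sub>R x \<in> sweep S x"
  unfolding sweep_def by blast

lemma sweepE:
  assumes "z \<in> sweep S x"
  obtains y t where "z = y + t *\<^sub>R x" "y \<in> S" "0 \<le> t" "t \<le> 1"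
  using assms unfolding sweep_def by blast

text \<open>
  A point that has been moved out of \<open>P\<close> is swept by the facet through which it has left, and this
  facet is unique up to a null set.
\<close>

lemma measure_sweep_polytope:
  fixes P :: "'a::euclidean_space set"
  assumes P: "full_dim_polytope P"
    and n: "\<And>F. F facet_of P \<Longrightarrow> facet_normal P F (a F) (b F)"
    and mem: "\<And>z. (\<And>F. F facet_of P \<Longrightarrow> a F \<bullet> z \<le> b F) \<Longrightarrow> z \<in> P"
  shows "measure lebesgue (sweep P x) =
    measure lebesgue P + (\<Sum>F | F facet_of P \<and> a F \<bullet> x > 0. measure lebesgue (sweep F x))"
proof -
  define Out where "Out = {F. F facet_of P \<and> a F \<bullet> x > 0}"
  have Out: "F facet_of P" "a F \<bullet> x > 0" if "F \<in> Out" for F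
    using that unfolding Out_def by blast+
  have finO: "finite Out"
    using finite_subset[OF _ finite_facets[OF P], of Out] unfolding Out_def by blast
  have on: "a F \<bullet> f = b F" if "F facet_of P" "f \<in> F" for F f
    using n[OF that(1)] that(2) unfolding facet_normal_def by blast
  have le: "a F \<bullet> f \<le> b F" if "F facet_of P" "f \<in> P" for F f
    using n[OF that(1)] that(2) unfolding facet_normal_def by blast
  have sub: "f \<in> P" if "F facet_of P" "f \<in> F" for F f
    using facet_of_imp_subset that by blast
  have onI: "f \<in> F" if "F facet_of P" "f \<in> P" "a F \<bullet> f = b F" for F f
    using n[OF that(1)] that(2,3) unfolding facet_normal_def by blast
  have comp: "compact (sweep F x)" if "F \<in> Out" for F
    using compact_sweep facet_aff_dim(5)[OF P Out(1)[OF that]] by blast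
  \<comment> \<open>The empty third set fits the union to the additivity rule
    \<open>measure_Un3_negligible\<close>.\<close>
  have cover: "sweep P x = P \<union> \<Union>((\<lambda>F. sweep F x) ` Out) \<union> {}"
  proof -
    have "z \<in> P \<union> \<Union>((\<lambda>F. sweep F x) ` Out)" if z: "z \<in> sweep P x" for z
    proof (cases "z \<in> P")
      case False
      obtain p s where p: "z = p + s *\<^sub>R x" "p \<in> P" "0 \<le> s" "s \<le> 1"
        using z by (rule sweepE)
      obtain G where G: "G facet_of P" "a G \<bullet> z > b G"
        using mem[of z] False not_le by blast
      \<comment> \<open>The time at which the line from \<open>p\<close> in direction
        \<open>x\<close> meets the hyperplane of \<open>F\<close>. Its minimum over
        \<open>Out\<close> is the time of exit from \<open>P\<close>.\<close>
      define r where "r F = (b F - a F \<bullet> p) / (a F \<bullet> x)" for F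
      have bG: "b G < a G \<bullet> p + s * (a G \<bullet> x)"
        using G(2) p(1) by (simp add: inner_add_right)
      with le[OF G(1) p(2)] have "0 < s * (a G \<bullet> x)" by linarith
      then have Gx: "a G \<bullet> x > 0"
        using p(3) by (simp add: zero_less_mult_iff)
      then have GO: "G \<in> Out" using G(1) unfolding Out_def by blast
      have rG: "r G < s"
        using Gx bG by (simp add: r_def field_simps)
      obtain F where F: "F \<in> Out" and min: "\<And>H. H \<in> Out \<Longrightarrow> r F \<le> r H"
        using arg_min_if_finite(1)[OF finO, of r] arg_min_least[OF finO, of _ r] GO by blast
      have r0: "0 \<le> r F"
        using le[OF Out(1)[OF F] p(2)] Out(2)[OF F] by (simp add: r_def)
      have rs: "r F < s" using min[OF GO] rG by linarith
      define f where "f = p + r F *\<^sub>R x"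
      \<comment> \<open>Hyperplanes of facets in \<open>Out\<close> are not passed before the
        minimal time; for the other facets, moving along \<open>x\<close> does not increase the
        conormal.\<close>
      have "a H \<bullet> f \<le> b H" if H: "H facet_of P" for H
      proof (cases "H \<in> Out")
        case True
        then have "r F \<le> (b H - a H \<bullet> p) / (a H \<bullet> x)"
          using min[OF True] by (simp add: r_def)
        then have "r F * (a H \<bullet> x) \<le> b H - a H \<bullet> p"
          using Out(2)[OF True] by (simp add: pos_le_divide_eq)
        then show ?thesis by (simp add: f_def inner_add_right)
      next
        case False
        then have "a H \<bullet> x \<le> 0" using H unfolding Out_def by auto
        then have "r F * (a H \<bullet> x) \<le> 0"
          using r0 by (simp add: mult_nonneg_nonpos)
        then show ?thesis using le[OF H p(2)] by (simp add: f_def inner_add_right)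
      qed
      then have "f \<in> P" by (rule mem)
      moreover have "a F \<bullet> f = b F"
        using Out(2)[OF F] by (simp add: f_def inner_add_right r_def)
      ultimately have "f \<in> F" using onI Out(1)[OF F] by blast
      moreover have "z = f + (s - r F) *\<^sub>R x"
        by (simp add: p(1) f_def algebra_simps)
      ultimately have "z \<in> sweep F x"
        using sweepI[of f F "s - r F" x] rs r0 p(4) by simp
      then show ?thesis using F by blast
    qed simp
    moreover have "P \<subseteq> sweep P x"
      using sweepI[of _ P 0 x] by force
    moreover have "sweep F x \<subseteq> sweep P x" if "F \<in> Out" for F
      using sub[OF Out(1)[OF that]] unfolding sweep_def by blast
    ultimately show ?thesis by blast
  qed
  have nonpos: "t \<le> 0" if "F \<in> Out" "f \<in> F" "f + t *\<^sub>R x \<in> P" for F f t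
  proof -
    have "t * (a F \<bullet> x) \<le> 0"
      using le[OF Out(1)[OF that(1)] that(3)] on[OF Out(1)[OF that(1)] that(2)]
      by (simp add: inner_add_right)
    then show ?thesis
      using Out(2)[OF that(1)] by (simp add: mult_le_0_iff)
  qed
  have "pairwise (\<lambda>F G. negligible (sweep F x \<inter> sweep G x)) Out"
  proof (rule pairwiseI)
    fix F G assume FG: "F \<in> Out" "G \<in> Out" "F \<noteq> G"
    \<comment> \<open>This combination of the two conormals kills \<open>x\<close>, so it is
      constant along the sweeping direction and confines the overlap to a hyperplane. It vanishes
      only for proportional conormals, which would force \<open>F = G\<close>.\<close>
    define l where "l = (a G \<bullet> x) *\<^sub>R a F - (a F \<bullet> x) *\<^sub>R a G"
    have "l \<noteq> 0"
    proof
      assume "l = 0"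
      define c where "c = (a F \<bullet> x) / (a G \<bullet> x)"
      have "c > 0"
        using Out(2)[OF FG(1)] Out(2)[OF FG(2)] by (simp add: c_def)
      have "(a G \<bullet> x) *\<^sub>R a F = (a G \<bullet> x) *\<^sub>R (c *\<^sub>R a G)"
        using \<open>l = 0\<close> Out(2)[OF FG(2)] by (simp add: l_def c_def)
      then have aF: "a F = c *\<^sub>R a G"
        using Out(2)[OF FG(2)] by (metis less_irrefl scaleR_left_imp_eq)
      obtain f f' where f: "f \<in> F" "f' \<in> G"
        using facet_aff_dim(2)[OF P Out(1)] FG by blast
      have "c * (a G \<bullet> f) = b F"
        using on[OF Out(1)[OF FG(1)] f(1)] aF by simp
      moreover have "c * (a G \<bullet> f) \<le> c * b G"
        using le[OF Out(1)[OF FG(2)] sub[OF Out(1)[OF FG(1)] f(1)]] \<open>c > 0\<close> by simp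
      moreover have "c * b G \<le> b F"
        using le[OF Out(1)[OF FG(1)] sub[OF Out(1)[OF FG(2)] f(2)]] on[OF Out(1)[OF FG(2)] f(2)] aF
        by simp
      ultimately have bF: "b F = c * b G" by linarith
      have "y \<in> F \<longleftrightarrow> y \<in> G" for y
      proof -
        have "a F \<bullet> y = b F \<longleftrightarrow> a G \<bullet> y = b G"
          unfolding aF bF using \<open>c > 0\<close> by simp
        then show ?thesis
          using on onI sub Out(1)[OF FG(1)] Out(1)[OF FG(2)] by metis
      qed
      then show False using FG(3) by blast
    qed
    moreover have "sweep F x \<inter> sweep G x \<subseteq> {z. l \<bullet> z = (a G \<bullet> x) * b F - (a F \<bullet> x) * b G}"
    proof
      fix z assume "z \<in> sweep F x \<inter> sweep G x"
      then obtain f s f' t where z: "z = f + s *\<^sub>R x" "f \<in> F" "z = f' + t *\<^sub>R x" "f' \<in> G"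
        by (metis IntE sweepE)
      have f: "f = f' + (t - s) *\<^sub>R x" "f' = f + (s - t) *\<^sub>R x"
        using z by (simp_all add: algebra_simps)
      \<comment> \<open>The two foot points of \<open>z\<close> differ by a multiple of
        \<open>x\<close>. Neither may lie ahead of the other, as no point of an exit facet can move
        forward within \<open>P\<close>; so they coincide and lie in both facets.\<close>
      have "s - t \<le> 0"
        using nonpos[OF FG(1) z(2), of "s - t"] f(2) sub[OF Out(1)[OF FG(2)] z(4)] by simp
      moreover have "t - s \<le> 0"
        using nonpos[OF FG(2) z(4), of "t - s"] f(1) sub[OF Out(1)[OF FG(1)] z(2)] by simp
      ultimately have "f = f'" using f by simp
      then have "a F \<bullet> f = b F" "a G \<bullet> f = b G"
        using on Out(1) FG z by blast+
      then show "z \<in> {z. l \<bullet> z = (a G \<bullet> x) * b F - (a F \<bullet> x) * b G}"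
        by (simp add: z(1) l_def inner_diff_left inner_add_right algebra_simps)
    qed
    ultimately show "negligible (sweep F x \<inter> sweep G x)"
      using negligible_hyperplane negligible_subset by blast
  qed
  then have "measure lebesgue (\<Union>((\<lambda>F. sweep F x) ` Out)) = (\<Sum>F\<in>Out. measure lebesgue (sweep F x))"
    using finO comp lmeasurable_compact by (intro measure_negligible_finite_Union_image) blast+
  moreover have "negligible (P \<inter> \<Union>((\<lambda>F. sweep F x) ` Out))"
  proof (rule negligible_subset)
    have "a F \<noteq> 0" if "F \<in> Out" for F
      using Out(2)[OF that] by auto
    then show "negligible (\<Union>F\<in>Out. {z. a F \<bullet> z = b F})"
      using finO by (intro negligible_Union) (auto intro!: negligible_hyperplane)
    show "P \<inter> \<Union>((\<lambda>F. sweep F x) ` Out) \<subseteq> (\<Union>F\<in>Out. {z. a F \<bullet> z = b F})"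
    proof
      fix z assume "z \<in> P \<inter> \<Union>((\<lambda>F. sweep F x) ` Out)"
      then obtain F f t where z: "z \<in> P" "F \<in> Out" "z = f + t *\<^sub>R x" "f \<in> F" "0 \<le> t"
        by (auto elim!: sweepE)
      then have "t = 0"
        using nonpos[of F f t] by simp
      then show "z \<in> (\<Union>F\<in>Out. {z. a F \<bullet> z = b F})"
        using z on Out(1) by auto
    qed
  qed
  moreover have "\<Union>((\<lambda>F. sweep F x) ` Out) \<in> lmeasurable"
    using finO comp by (intro lmeasurable_compact compact_UN)
  ultimately show ?thesis
    using measure_Un3_negligible[OF lmeasurable_compact[OF compact_full_dim[OF P]] _ _ _ _ _
        cover[symmetric]]
    by (simp add: Out_def)
qed

text \<open>Reversing the parameter, \<open>t \<mapsto> 1 - t\<close>, exhibits one set as a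
  translate of the other.\<close>

lemma measure_sweep_uminus: "measure lebesgue (sweep S (- x)) = measure lebesgue (sweep S x)"
  for S :: "'a::euclidean_space set"
proof -
  have "sweep S x = (+) x ` sweep S (- x)"
  proof (intro antisym subsetI)
    fix z assume "z \<in> sweep S x"
    then obtain y t where z: "z = y + t *\<^sub>R x" "y \<in> S" "0 \<le> t" "t \<le> 1" by (rule sweepE)
    then have "z = x + (y + (1 - t) *\<^sub>R (- x))" by (simp add: algebra_simps)
    then show "z \<in> (+) x ` sweep S (- x)"
      using sweepI[of y S "1 - t" "- x"] z by simp
  next
    fix z assume "z \<in> (+) x ` sweep S (- x)"
    then obtain y t where z: "z = x + (y + t *\<^sub>R (- x))" "y \<in> S" "0 \<le> t" "t \<le> 1"
      by (auto elim!: sweepE)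
    then have "z = y + (1 - t) *\<^sub>R x" by (simp add: algebra_simps)
    then show "z \<in> sweep S x"
      using sweepI[of y S "1 - t" x] z(2-4) by (simp only: diff_ge_0_iff_ge diff_le_eq le_add_same_cancel1)
  qed
  then show ?thesis
    by (simp add: measure_translation)
qed

theorem sum_weighted_normals:
  fixes P :: "'a::euclidean_space set"
  assumes vol: "volume_form g vol" and P: "full_dim_polytope P"
  shows "(\<Sum>F | F facet_of P. weighted_normal vol P F) = 0"
proof (rule blinfun_eqI)
  fix x
  obtain a b where n: "\<And>F. F facet_of P \<Longrightarrow> facet_normal P F (a F) (b F)"
    and mem: "\<And>z. (\<And>F. F facet_of P \<Longrightarrow> a F \<bullet> z \<le> b F) \<Longrightarrow> z \<in> P"
    using facet_normals_exist[OF P] by blast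
  define k where "k = \<bar>vol basis_list\<bar>"
  \<comment> \<open>Facets through which \<open>x\<close> leaves contribute \<open>up x\<close>,
    those through which it enters contribute \<open>up (- x)\<close> with a minus sign, and facets
    parallel to \<open>x\<close> contribute nothing.\<close>
  define up where "up y F = (if a F \<bullet> y > 0 then measure lebesgue (sweep F y) else 0)" for y F
  have w: "blinfun_apply (weighted_normal vol P F) x = k * up x F - k * up (- x) F"
    if F: "F facet_of P" for F
  proof -
    obtain K where K: "\<forall>x. blinfun_apply (weighted_normal vol P F) x = K * (a F \<bullet> x)"
      "\<forall>x. a F \<bullet> x > 0 \<longrightarrow> K * (a F \<bullet> x) = k * measure lebesgue (sweep F x)"
      using weighted_normal_eq[OF vol P n[OF F]] unfolding k_def by blast
    show ?thesis
      using K(1)[THEN spec, of x] K(2)[THEN spec, of x] K(2)[THEN spec, of "- x"]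
      by (cases "a F \<bullet> x" "0 :: real" rule: linorder_cases) (auto simp: up_def)
  qed
  have up: "(\<Sum>F | F facet_of P. up y F) = measure lebesgue (sweep P y) - measure lebesgue P" for y
    using measure_sweep_polytope[of P a b y, OF P n mem] finite_facets[OF P]
    by (simp add: up_def sum.inter_filter[symmetric])
  have "blinfun_apply (\<Sum>F | F facet_of P. weighted_normal vol P F) x
      = (\<Sum>F | F facet_of P. k * up x F - k * up (- x) F)"
    by (simp add: blinfun.sum_left w)
  also have "\<dots> = k * (\<Sum>F | F facet_of P. up x F) - k * (\<Sum>F | F facet_of P. up (- x) F)"
    by (simp add: sum_subtractf sum_distrib_left)
  also have "\<dots> = 0"
    unfolding up measure_sweep_uminus by simp
  finally show "blinfun_apply (\<Sum>F | F facet_of P. weighted_normal vol P F) x = blinfun_apply 0 x"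
    by simp
qed

section \<open>Polyhedral subdivisions and their dual graphs\<close>

text \<open>For small \<open>t\<close> the point \<open>x + t *\<^sub>R d\<close> is a convex
  combination of a fixed interior point \<open>z\<close> of \<open>P\<close> and a point
  \<open>f\<close> of \<open>F\<close> close to \<open>x\<close>.\<close>

lemma facet_inner_side:
  fixes P :: "'a::euclidean_space set"
  assumes P: "full_dim_polytope P" and n: "facet_normal P F a b"
    and x: "x \<in> rel_interior F" and d: "a \<bullet> d < 0"
  obtains e where "e > 0" "\<And>t. 0 < t \<Longrightarrow> t \<le> e \<Longrightarrow> x + t *\<^sub>R d \<in> P"
proof -
  have F: "F facet_of P" "F \<subseteq> {x. a \<bullet> x = b}" "a \<noteq> 0" "F \<subseteq> P" "\<forall>x\<in>P. a \<bullet> x \<le> b"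
    using n unfolding facet_normal_def by blast+
  note facet = facet_aff_dim[OF P F(1)]
  have hull: "affine hull F = {x. a \<bullet> x = b}"
    by (rule affine_hull_facet[OF facet(1,2) F(2,3)])
  obtain z where z: "z \<in> interior P"
    using full_dim_interior_nonempty[OF P] by blast
  have zP: "z \<in> P" and zb: "a \<bullet> z < b"
    using z interior_subset interior_halfspace_lt[OF F(5,3) z] by blast+
  obtain r where r: "r > 0" "ball x r \<inter> affine hull F \<subseteq> F" and xF: "x \<in> F"
    using x unfolding mem_rel_interior_ball by blast
  have xb: "a \<bullet> x = b" using xF F(2) by blast
  \<comment> \<open>Chosen so that \<open>d\<close> and \<open>k *\<^sub>R (z - x)\<close> have the
    same component across the facet; their difference \<open>w\<close> is then parallel to
    it.\<close>
  define k where "k = (- (a \<bullet> d)) / (b - a \<bullet> z)"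
  have k: "k > 0" using d zb by (simp add: k_def divide_neg_pos)
  define w where "w = d - k *\<^sub>R (z - x)"
  have "k * (a \<bullet> (z - x)) = a \<bullet> d"
    using zb by (simp add: k_def xb inner_diff_right field_simps)
  then have aw: "a \<bullet> w = 0"
    by (simp add: w_def inner_diff_right)
  \<comment> \<open>The first bound keeps the weight \<open>s = t * k\<close> of \<open>z\<close> at
    most 1/2, hence \<open>t / (1 - s) \<le> 2 * t\<close>; the second then keeps \<open>f\<close>
    within distance \<open>r\<close> of \<open>x\<close>. Adding 1 to \<open>norm w\<close> covers
    \<open>w = 0\<close>.\<close>
  define e where "e = min (1 / (2 * k)) (r / (2 * (norm w + 1)))"
  have "e > 0" using k r(1) norm_ge_zero[of w] by (simp add: e_def add_nonneg_pos)
  moreover have "x + t *\<^sub>R d \<in> P" if t: "0 < t" "t \<le> e" for t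
  proof -
    define s where "s = t * k"
    have "t \<le> 1 / (2 * k)" using t by (simp add: e_def)
    then have s: "0 < s" "s \<le> 1 / 2"
      using k t by (simp_all add: s_def field_simps)
    define f where "f = x + (t / (1 - s)) *\<^sub>R w"
    have "norm ((t / (1 - s)) *\<^sub>R w) = (t / (1 - s)) * norm w"
      using t s by simp
    also have "\<dots> \<le> (2 * t) * norm w"
    proof (rule mult_right_mono)
      have "t * 1 \<le> t * (2 * (1 - s))"
        using t s by (intro mult_left_mono) auto
      then show "t / (1 - s) \<le> 2 * t"
        using s by (simp add: field_simps)
    qed simp
    also have "\<dots> < (2 * t) * (norm w + 1)"
      using t by simp
    also have "\<dots> \<le> r"
    proof -
      have pos: "0 < 2 * (norm w + 1)" by (simp add: add_nonneg_pos)
      have "t \<le> r / (2 * (norm w + 1))" using t by (simp add: e_def)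
      then have "t * (2 * (norm w + 1)) \<le> r" using pos by (simp add: pos_le_divide_eq)
      then show ?thesis by (simp add: mult_ac)
    qed
    finally have "f \<in> ball x r"
      by (simp add: f_def dist_norm)
    moreover have "f \<in> affine hull F"
      unfolding hull f_def by (simp add: inner_add_right xb aw)
    ultimately have "f \<in> P" using r F by blast
    then have "(1 - s) *\<^sub>R f + s *\<^sub>R z \<in> P"
      using convexD_alt[OF convex_full_dim[OF P] _ zP] s by simp
    moreover have "(1 - s) *\<^sub>R f + s *\<^sub>R z = x + t *\<^sub>R d"
    proof -
      have "(1 - s) *\<^sub>R f = (1 - s) *\<^sub>R x + t *\<^sub>R w"
        using s by (simp add: f_def scaleR_add_right)
      then show ?thesis
        by (simp add: w_def s_def algebra_simps)
    qed
    ultimately show ?thesis by simp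
  qed
  ultimately show ?thesis using that by blast
qed

text \<open>A face strictly between a facet and the polytope would need a dimension strictly between
  two consecutive integers.\<close>

lemma facet_maximal:
  fixes P :: "'a::euclidean_space set"
  assumes P: "full_dim_polytope P" and F: "F facet_of P" and G: "G face_of P" "G \<noteq> P" "F \<subseteq> G"
  shows "G = F"
proof (rule ccontr)
  assume "G \<noteq> F"
  have "aff_dim G < aff_dim P"
    using face_of_aff_dim_lt[OF convex_full_dim[OF P]] G by blast
  moreover have "F face_of G"
    using face_of_subset[OF facet_of_imp_face_of[OF F] G(3)] face_of_imp_subset[OF G(1)] by blast
  then have "aff_dim F < aff_dim G"
    using face_of_aff_dim_lt[OF face_of_imp_convex[OF G(1) ]] convex_full_dim[OF P] \<open>G \<noteq> F\<close> by blast
  ultimately show False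
    using facet_aff_dim(1)[OF P F] P by (simp add: full_dim_polytope_def)
qed

lemma subdivisionD:
  assumes "polyhedral_subdivision Q \<P>"
  shows "finite \<P>" "P \<in> \<P> \<Longrightarrow> full_dim_polytope P" "\<Union>\<P> = Q"
    "P \<in> \<P> \<Longrightarrow> P' \<in> \<P> \<Longrightarrow> P \<noteq> P' \<Longrightarrow> P \<inter> P' face_of P"
    "P \<in> \<P> \<Longrightarrow> P' \<in> \<P> \<Longrightarrow> P \<noteq> P' \<Longrightarrow> P \<inter> P' \<noteq> P"
  using assms unfolding polyhedral_subdivision_def by blast+

text \<open>The intersection of the two cells is a proper face containing a facet, so by maximality
  it is that facet; as a face of \<open>P'\<close> it also has the dimension of a facet.\<close>

lemma subdivision_facet_eq_Int:
  fixes Q :: "'a::euclidean_space set"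
  assumes sub: "polyhedral_subdivision Q \<P>" and P: "P \<in> \<P>" "P' \<in> \<P>" "P \<noteq> P'"
    and F: "F facet_of P" "F \<subseteq> P'"
  shows "P \<inter> P' = F" "F facet_of P'"
proof -
  have "F \<subseteq> P" using facet_of_imp_subset[OF F(1)] .
  then show eq: "P \<inter> P' = F"
    using facet_maximal[OF subdivisionD(2)[OF sub P(1)] F(1)] subdivisionD(4,5)[OF sub P] F(2)
    by blast
  have "P' \<inter> P face_of P'"
    using subdivisionD(4)[OF sub P(2,1)] P(3) by blast
  then have "F face_of P'" using eq by (simp add: Int_commute)
  moreover have "aff_dim F = aff_dim P' - 1" "F \<noteq> {}"
    using facet_aff_dim(1,2)[OF subdivisionD(2)[OF sub P(1)] F(1)] subdivisionD(2)[OF sub P(2)]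
    by (simp_all add: full_dim_polytope_def)
  ultimately show "F facet_of P'"
    unfolding facet_of_def by blast
qed

lemma rel_interior_facet_nonempty:
  assumes "full_dim_polytope P" "F facet_of P"
  obtains x where "x \<in> rel_interior F"
  using facet_aff_dim[OF assms] rel_interior_eq_empty[of F] by blast

text \<open>The normals of the two cells are proportional. With a positive factor, both cells would
  contain a short segment leaving \<open>F\<close> in direction \<open>- a\<close>, although they
  meet only in \<open>F\<close>.\<close>

lemma subdivision_opposite_normal:
  fixes Q :: "'a::euclidean_space set"
  assumes sub: "polyhedral_subdivision Q \<P>" and P: "P \<in> \<P>" "P' \<in> \<P>" "P \<noteq> P'"
    and n: "facet_normal P F a b" and F': "F facet_of P'"
  shows "facet_normal P' F (- a) (- b)"
proof -
  note fP = subdivisionD(2)[OF sub P(1)] and fP' = subdivisionD(2)[OF sub P(2)]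
  have F: "F facet_of P" "F \<subseteq> {x. a \<bullet> x = b}" "a \<noteq> 0"
    using n unfolding facet_normal_def by blast+
  obtain a' b' where n': "facet_normal P' F a' b'"
    using facet_normal_exists[OF fP' F'] by blast
  have F2: "F \<subseteq> {x. a' \<bullet> x = b'}" "a' \<noteq> 0"
    using n' unfolding facet_normal_def by blast+
  obtain c where c: "c \<noteq> 0" "a' = c *\<^sub>R a" "b' = c * b"
    using facet_normal_unique[OF facet_aff_dim(1,2)[OF fP F(1)] F(2,3) F2] by blast
  have aa: "a \<bullet> a > 0" using F(3) by simp
  have "\<not> c > 0"
  proof
    assume "c > 0"
    obtain x where x: "x \<in> rel_interior F"
      using rel_interior_facet_nonempty[OF fP F(1)] by blast
    have "a \<bullet> (- a) < 0" "a' \<bullet> (- a) < 0"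
      using aa \<open>c > 0\<close> c by simp_all
    then obtain e e' where e: "e > 0" "\<And>t. 0 < t \<Longrightarrow> t \<le> e \<Longrightarrow> x + t *\<^sub>R (- a) \<in> P"
      and e': "e' > 0" "\<And>t. 0 < t \<Longrightarrow> t \<le> e' \<Longrightarrow> x + t *\<^sub>R (- a) \<in> P'"
      using facet_inner_side[OF fP n x] facet_inner_side[OF fP' n' x] by metis
    define t where "t = min e e'"
    have t: "0 < t" "t \<le> e" "t \<le> e'" using e(1) e'(1) by (auto simp: t_def)
    have "x + t *\<^sub>R (- a) \<in> F"
      using e(2)[OF t(1,2)] e'(2)[OF t(1,3)]
        subdivision_facet_eq_Int(1)[OF sub P F(1) facet_of_imp_subset[OF F']] by blast
    moreover have "x \<in> F" using x rel_interior_subset by blast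
    ultimately have "a \<bullet> (x + t *\<^sub>R (- a)) = b" "a \<bullet> x = b"
      using F(2) by blast+
    then show False using t(1) aa by (simp add: inner_diff_right)
  qed
  then have c0: "c < 0" using c(1) by simp
  have "- a \<bullet> y \<le> - b" if "y \<in> P'" for y
  proof -
    have "c * (a \<bullet> y) \<le> c * b"
      using n' that c unfolding facet_normal_def by auto
    then show ?thesis using c0 by (simp add: mult_le_cancel_left)
  qed
  moreover have "F = P' \<inter> {x. - a \<bullet> x = - b}"
  proof -
    have "F = P' \<inter> {x. a' \<bullet> x = b'}"
      using n' unfolding facet_normal_def by blast
    moreover have "a' \<bullet> x = b' \<longleftrightarrow> - a \<bullet> x = - b" for x
      using c by simp
    ultimately show ?thesis by simp
  qed
  ultimately show ?thesis
    using F(3) F' unfolding facet_normal_def by simp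
qed

text \<open>A third cell would lie opposite to \<open>P\<close> and opposite to \<open>P'\<close>,
  hence on both sides of the hyperplane of \<open>F\<close> at once.\<close>

lemma subdivision_facet_shared_by_two:
  fixes Q :: "'a::euclidean_space set"
  assumes sub: "polyhedral_subdivision Q \<P>" and P: "P \<in> \<P>" "P' \<in> \<P>" "P \<noteq> P'"
    and F: "F facet_of P" "F facet_of P'"
  shows "{P \<in> \<P>. F facet_of P} = {P, P'}"
proof -
  have "P'' = P \<or> P'' = P'" if P'': "P'' \<in> \<P>" "F facet_of P''" for P''
  proof (rule ccontr)
    assume ne: "\<not> (P'' = P \<or> P'' = P')"
    obtain a b where n: "facet_normal P F a b"
      using facet_normal_exists[OF subdivisionD(2)[OF sub P(1)] F(1)] by blast
    have n': "facet_normal P' F (- a) (- b)"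
      by (rule subdivision_opposite_normal[OF sub P n F(2)])
    have n'': "facet_normal P'' F (- a) (- b)"
      by (rule subdivision_opposite_normal[OF sub P(1) P''(1) _ n P''(2)]) (use ne in blast)
    have "facet_normal P'' F (- (- a)) (- (- b))"
      by (rule subdivision_opposite_normal[OF sub P(2) P''(1) _ n' P''(2)]) (use ne in blast)
    moreover obtain y where "y \<in> interior P''"
      using full_dim_interior_nonempty[OF subdivisionD(2)[OF sub P''(1)]] by blast
    ultimately have "- (- a) \<bullet> y < - (- b)" "- a \<bullet> y < - b"
      using n'' interior_halfspace_lt[of P'' _ _ y] unfolding facet_normal_def by blast+
    then show False by simp
  qed
  then show ?thesis using P F by blast
qed

text \<open>Keeps edges and legs disjoint. A functional \<open>h\<close> supporting \<open>Q\<close>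
  at a relative interior point of \<open>F\<close> would vanish in every direction transversal to
  \<open>F\<close>, since one can move forward into one cell and backward into the other; these
  directions span the space.\<close>

lemma subdivision_internal_facet:
  fixes Q :: "'a::euclidean_space set"
  assumes sub: "polyhedral_subdivision Q \<P>" and Q: "full_dim_polytope Q"
    and P: "P \<in> \<P>" "P' \<in> \<P>" "P \<noteq> P'" and F: "F facet_of P" "F facet_of P'"
  shows "\<not> F \<subseteq> frontier Q"
proof
  assume front: "F \<subseteq> frontier Q"
  note fP = subdivisionD(2)[OF sub P(1)] and fP' = subdivisionD(2)[OF sub P(2)]
  obtain a b where n: "facet_normal P F a b"
    using facet_normal_exists[OF fP F(1)] by blast
  have n': "facet_normal P' F (- a) (- b)"
    by (rule subdivision_opposite_normal[OF sub P n F(2)])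
  obtain x where x: "x \<in> rel_interior F"
    using rel_interior_facet_nonempty[OF fP F(1)] by blast
  have PQ: "P \<subseteq> Q" "P' \<subseteq> Q"
    using P subdivisionD(3)[OF sub] by blast+
  have xF: "x \<in> F" using x rel_interior_subset by blast
  then have "x \<in> Q" "x \<notin> interior Q"
    using front facet_of_imp_subset[OF F(1)] PQ by (auto simp: frontier_def)
  then have "x \<notin> rel_interior Q"
    using rel_interior_nonempty_interior[OF full_dim_interior_nonempty[OF Q]] by simp
  then obtain h where h: "h \<noteq> 0" "\<And>y. y \<in> Q \<Longrightarrow> h \<bullet> x \<le> h \<bullet> y"
    using supporting_hyperplane_rel_boundary[OF convex_full_dim[OF Q] \<open>x \<in> Q\<close>] by metis
  have zero: "h \<bullet> d = 0" if d: "a \<bullet> d < 0" for d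
  proof -
    obtain e where e: "e > 0" "\<And>t. 0 < t \<Longrightarrow> t \<le> e \<Longrightarrow> x + t *\<^sub>R d \<in> P"
      using facet_inner_side[OF fP n x d] by blast
    obtain e' where e': "e' > 0" "\<And>t. 0 < t \<Longrightarrow> t \<le> e' \<Longrightarrow> x + t *\<^sub>R (- d) \<in> P'"
      using facet_inner_side[OF fP' n' x, of "- d"] d by auto
    have "x + e *\<^sub>R d \<in> Q" "x + e' *\<^sub>R (- d) \<in> Q"
      using e(2)[OF e(1) order_refl] e'(2)[OF e'(1) order_refl] PQ by blast+
    then have "h \<bullet> x \<le> h \<bullet> (x + e *\<^sub>R d)" "h \<bullet> x \<le> h \<bullet> (x + e' *\<^sub>R (- d))"
      using h(2) by blast+
    then have "0 \<le> e * (h \<bullet> d)" "e' * (h \<bullet> d) \<le> 0"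
      by (simp_all add: inner_add_right inner_diff_right)
    then show ?thesis
      using e(1) e'(1) by (simp add: zero_le_mult_iff mult_le_0_iff)
  qed
  have aa: "a \<bullet> a > 0" using n unfolding facet_normal_def by simp
  then have ha: "h \<bullet> a = 0" using zero[of "- a"] by simp
  \<comment> \<open>As \<open>h\<close> is orthogonal to \<open>a\<close>, the vector
    \<open>h - a\<close> is again strictly inward for \<open>P\<close>; testing \<open>h\<close> on
    it gives \<open>h \<bullet> h = 0\<close>.\<close>
  then have "h \<bullet> (h - a) = 0"
    using aa by (intro zero) (simp add: inner_diff_right inner_commute)
  then show False using ha h(1) by (simp add: inner_diff_right)
qed

text \<open>If a relative interior point of \<open>F\<close> were interior to \<open>Q\<close>, the
  other cells, whose union is closed, would have to contain it. The face
  \<open>P \<inter> P'\<close> then meets the relative interior of \<open>F\<close>, so it contains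
  \<open>F\<close> and makes it shared. Taking closures passes from the relative interior to
  \<open>F\<close>.\<close>

lemma subdivision_boundary_facet:
  fixes Q :: "'a::euclidean_space set"
  assumes sub: "polyhedral_subdivision Q \<P>" and Q: "full_dim_polytope Q"
    and P: "P \<in> \<P>" and F: "F facet_of P"
    and lonely: "\<And>P'. P' \<in> \<P> \<Longrightarrow> F facet_of P' \<Longrightarrow> P' = P"
  shows "F \<subseteq> frontier Q"
proof -
  note fP = subdivisionD(2)[OF sub P]
  obtain a b where n: "facet_normal P F a b"
    using facet_normal_exists[OF fP F] by blast
  have FP: "F \<subseteq> P" using facet_of_imp_subset[OF F] .
  have PQ: "P \<subseteq> Q" using P subdivisionD(3)[OF sub] by blast
  have "x \<notin> interior Q" if x: "x \<in> rel_interior F" for x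
  proof
    assume xQ: "x \<in> interior Q"
    have xF: "x \<in> F" using x rel_interior_subset by blast
    define K where "K = \<Union>(\<P> - {P})"
    have "closed K"
      unfolding K_def using subdivisionD(1,2)[OF sub] compact_full_dim compact_imp_closed
      by (intro closed_Union) blast+
    have "x \<in> K"
    proof (rule ccontr)
      assume "x \<notin> K"
      then have "x \<in> interior Q - K" "open (interior Q - K)"
        using xQ \<open>closed K\<close> by (auto intro: open_Diff)
      moreover have "interior Q - K \<subseteq> P"
        using interior_subset[of Q] subdivisionD(3)[OF sub] unfolding K_def by blast
      ultimately have "x \<in> interior P"
        by (meson interiorI)
      then show False
        using interior_halfspace_lt[of P a b x] n xF unfolding facet_normal_def by auto
    qed
    then obtain P' where P': "P' \<in> \<P>" "P \<noteq> P'" "x \<in> P'"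
      unfolding K_def by blast
    have "F \<subseteq> P \<inter> P'"
      using subset_of_face_of[OF subdivisionD(4)[OF sub P P'(1,2)] FP] x xF FP P'(3) by blast
    then have "F facet_of P'"
      using subdivision_facet_eq_Int(2)[OF sub P P'(1,2) F] by blast
    then show False using lonely P' by blast
  qed
  then have "rel_interior F \<subseteq> frontier Q"
    using rel_interior_subset[of F] FP PQ closure_subset[of Q] unfolding frontier_def by blast
  then have "closure (rel_interior F) \<subseteq> frontier Q"
    by (simp add: closure_minimal)
  then show ?thesis
    using convex_closure_rel_interior[OF facet_aff_dim(4)[OF fP F]] closure_subset[of F] by simp
qed

section \<open>Connectedness of the dual graph\<close>

lemma subdivision_low_dim_Int:
  fixes Q :: "'a::euclidean_space set"
  assumes sub: "polyhedral_subdivision Q \<P>" and P: "P \<in> \<P>" "P' \<in> \<P>" "P \<noteq> P'"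
    and no: "\<And>F. F facet_of P \<Longrightarrow> F facet_of P' \<Longrightarrow> False"
  shows "aff_dim (P \<inter> P') < int DIM('a) - 1"
proof (rule ccontr)
  assume ge: "\<not> ?thesis"
  note fP = subdivisionD(2)[OF sub P(1)]
  have dim: "aff_dim P = int DIM('a)"
    using fP by (simp add: full_dim_polytope_def)
  have face: "P \<inter> P' face_of P" "P \<inter> P' \<noteq> P"
    using subdivisionD(4,5)[OF sub P] by blast+
  then have "aff_dim (P \<inter> P') < aff_dim P"
    using face_of_aff_dim_lt[OF convex_full_dim[OF fP]] by blast
  then have eq: "aff_dim (P \<inter> P') = int DIM('a) - 1"
    using ge dim by simp
  \<comment> \<open>The empty set has affine dimension -1, which equals n - 1 only for n =
    0.\<close>
  have "P \<inter> P' \<noteq> {}"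
  proof
    assume "P \<inter> P' = {}"
    then show False using eq DIM_positive[where 'a='a] by simp
  qed
  then have "(P \<inter> P') facet_of P"
    using face eq dim unfolding facet_of_def by simp
  moreover from this have "(P \<inter> P') facet_of P'"
    using subdivision_facet_eq_Int(2)[OF sub P] by blast
  ultimately show False using no by blast
qed

text \<open>
  A generic segment from the interior of a cell avoids all faces of codimension at least two, so it
  can only pass from cell to cell through a common facet.
\<close>

lemma dual_graph_connected:
  fixes Q :: "'a::euclidean_space set"
  assumes sub: "polyhedral_subdivision Q \<P>" and Q: "full_dim_polytope Q"
    and P0: "P0 \<in> \<P>" and P1: "P1 \<in> \<P>"
  shows "(P0, P1) \<in> (adjacency (dual_graph Q \<P>))\<^sup>*"
proof (rule ccontr)
  define R where "R = adjacency (dual_graph Q \<P>)"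
  assume "(P0, P1) \<notin> (adjacency (dual_graph Q \<P>))\<^sup>*"
  then have P1R: "(P0, P1) \<notin> R\<^sup>*" by (simp add: R_def)
  have adj: "(P, P') \<in> R" if "P \<in> \<P>" "P' \<in> \<P>" "P \<noteq> P'" "F facet_of P" "F facet_of P'" for P P' F
  proof -
    have "F \<in> edges (dual_graph Q \<P>)"
      using that by (auto simp: dual_graph_def)
    moreover have "ends (dual_graph Q \<P>) F = {P, P'}"
      using subdivision_facet_shared_by_two[OF sub that] by (simp add: dual_graph_def)
    ultimately show ?thesis
      unfolding R_def adjacency_def by blast
  qed
  \<comment> \<open>\<open>A\<close> collects the cells reachable from \<open>P0\<close>,
    \<open>B\<close> the others. No cell of \<open>A\<close> shares a facet with one of
    \<open>B\<close>, so their intersections have codimension at least two.\<close>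
  define A where "A = {P \<in> \<P>. (P0, P) \<in> R\<^sup>*}"
  define B where "B = \<P> - A"
  have P0A: "P0 \<in> A" using P0 by (simp add: A_def)
  have P1B: "P1 \<in> B" using P1 P1R by (simp add: A_def B_def)
  have fin: "finite A" "finite B"
    using subdivisionD(1)[OF sub] by (simp_all add: A_def B_def)
  have AB: "A \<union> B = \<P>" "A \<subseteq> \<P>" "B \<subseteq> \<P>" "A \<inter> B = {}"
    unfolding A_def B_def by blast+
  have low: "aff_dim (X \<inter> Y) < int DIM('a) - 1" if X: "X \<in> A" and Y: "Y \<in> B" for X Y
  proof (rule subdivision_low_dim_Int[OF sub])
    show "X \<in> \<P>" "Y \<in> \<P>" "X \<noteq> Y" using X Y AB by blast+
    fix F assume F: "F facet_of X" "F facet_of Y"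
    have "(X, Y) \<in> R"
      using adj[OF \<open>X \<in> \<P>\<close> \<open>Y \<in> \<P>\<close> \<open>X \<noteq> Y\<close> F] .
    then have "Y \<in> A"
      using X \<open>Y \<in> \<P>\<close> unfolding A_def by (auto intro: rtrancl_into_rtrancl)
    then show False using Y AB by blast
  qed
  obtain p where p: "p \<in> interior P0"
    using full_dim_interior_nonempty[OF subdivisionD(2)[OF sub P0]] by blast
  \<comment> \<open>All lines from \<open>p\<close> through an intersection of a cell of
    \<open>A\<close> with a cell of \<open>B\<close>. Adding \<open>p\<close> raises the dimension
    by at most one, so these affine hulls are still null sets and some \<open>q\<close> inside
    \<open>P1\<close> avoids them.\<close>
  define N where "N = (\<Union>(X, Y)\<in>A \<times> B. affine hull (insert p (X \<inter> Y)))"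
  have "negligible N"
    unfolding N_def
  proof (rule negligible_Union)
    show "finite ((\<lambda>(X, Y). affine hull (insert p (X \<inter> Y))) ` (A \<times> B))"
      using fin by simp
    fix T assume "T \<in> (\<lambda>(X, Y). affine hull (insert p (X \<inter> Y))) ` (A \<times> B)"
    then obtain X Y where T: "T = affine hull (insert p (X \<inter> Y))" "X \<in> A" "Y \<in> B"
      by auto
    have "aff_dim T < int DIM('a)"
      using low[OF T(2,3)] by (simp add: T(1) aff_dim_insert)
    then have "interior T = {}"
      by (intro low_dim_interior) simp
    moreover have "convex T"
      by (simp add: T(1) affine_imp_convex)
    ultimately show "negligible T"
      using negligible_convex_interior by blast
  qed
  then have "\<not> interior P1 \<subseteq> N"
    using full_dim_interior_nonempty[OF subdivisionD(2)[OF sub P1]] open_not_negligible[of "interior P1"]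
      negligible_subset by blast
  then obtain q where q: "q \<in> interior P1" "q \<notin> N" by blast
  have cl: "closed (\<Union>A)" "closed (\<Union>B)"
  proof -
    have "closed X" if "X \<in> \<P>" for X
      using compact_imp_closed[OF compact_full_dim[OF subdivisionD(2)[OF sub that]]] .
    then show "closed (\<Union>A)" "closed (\<Union>B)"
      using fin AB(2,3) by (auto intro!: closed_Union)
  qed
  have pq: "p \<in> \<Union>A" "q \<in> \<Union>B"
    using p q(1) P0A P1B interior_subset by blast+
  have "closed_segment p q \<subseteq> Q"
    using pq AB subdivisionD(3)[OF sub] convex_full_dim[OF Q]
    by (intro closed_segment_subset) blast+
  then have cover: "closed_segment p q \<subseteq> \<Union>A \<union> \<Union>B"
    using subdivisionD(3)[OF sub] AB by blast
  \<comment> \<open>The segment is connected and covered by two closed sets, each of which contains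
    one of its ends.\<close>
  have "\<Union>A \<inter> \<Union>B \<inter> closed_segment p q \<noteq> {}"
  proof
    assume emp: "\<Union>A \<inter> \<Union>B \<inter> closed_segment p q = {}"
    have "\<Union>A \<inter> closed_segment p q \<noteq> {}" "\<Union>B \<inter> closed_segment p q \<noteq> {}"
      using pq ends_in_segment by blast+
    then show False
      using connected_closedD[OF connected_segment(1) emp cover cl] by blast
  qed
  then obtain z X Y where z: "z \<in> closed_segment p q" "X \<in> A" "Y \<in> B" "z \<in> X" "z \<in> Y"
    by blast
  show False
  proof (cases "z = p")
    case True
    have "P0 \<inter> Y face_of P0" "P0 \<inter> Y \<noteq> P0"
      using subdivisionD(4,5)[OF sub P0, of Y] z P0A AB by blast+
    then have "P0 \<inter> Y \<inter> interior P0 = {}"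
      using face_of_disjoint_interior by blast
    then show False using True z p interior_subset by blast
  next
    case False
    obtain t where t: "z = (1 - t) *\<^sub>R p + t *\<^sub>R q"
      using z(1) by (auto simp: closed_segment_def)
    with False have "t \<noteq> 0" by auto
    \<comment> \<open>Extending the line from \<open>p\<close> through the meeting point
      \<open>z\<close> recovers \<open>q\<close>, which puts \<open>q\<close> into
      \<open>N\<close>.\<close>
    have "(1 - 1 / t) *\<^sub>R p + (1 / t) *\<^sub>R z \<in> affine hull (insert p (X \<inter> Y))"
      using z by (intro mem_affine affine_affine_hull hull_inc) auto
    moreover have "(1 - 1 / t) *\<^sub>R p + (1 / t) *\<^sub>R z = q"
      unfolding t using \<open>t \<noteq> 0\<close> by (simp add: algebra_simps)
    ultimately have "q \<in> N"
      unfolding N_def using z by blast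
    then show False using q by blast
  qed
qed

section \<open>Jumps of the gradient and signs across internal facets\<close>

lemma regular_jump:
  fixes Q :: "'a::euclidean_space set" and \<xi> :: "'a set \<Rightarrow> 'a \<Rightarrow>\<^sub>L real"
  assumes sub: "polyhedral_subdivision Q \<P>" and P: "P \<in> \<P>" "P' \<in> \<P>" "P \<noteq> P'"
    and n: "facet_normal P F a b" and F': "F facet_of P'"
    and f: "convex_on Q f" "\<And>P x. P \<in> \<P> \<Longrightarrow> x \<in> P \<Longrightarrow> f x = blinfun_apply (\<xi> P) x + c P"
    and ne: "(\<xi> P, c P) \<noteq> (\<xi> P', c P')"
  obtains k where "k > 0" "\<And>x. blinfun_apply (\<xi> P') x - blinfun_apply (\<xi> P) x = k * (a \<bullet> x)"
proof -
  note fP = subdivisionD(2)[OF sub P(1)] and fP' = subdivisionD(2)[OF sub P(2)]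
  have n': "facet_normal P' F (- a) (- b)"
    by (rule subdivision_opposite_normal[OF sub P n F'])
  have F: "F facet_of P" "F \<subseteq> {x. a \<bullet> x = b}" "a \<noteq> 0" "F \<subseteq> P" "F \<subseteq> P'"
    using n n' unfolding facet_normal_def by blast+
  have PQ: "P \<subseteq> Q" "P' \<subseteq> Q"
    using P subdivisionD(3)[OF sub] by blast+
  have aa: "a \<bullet> a > 0" using F(3) by simp
  \<comment> \<open>The jump of the linear part. Both affine pieces agree with \<open>f\<close> on
    \<open>F\<close>, so \<open>D\<close> is constant there, vanishes on the directions of
    \<open>F\<close> and is a multiple of the conormal.\<close>
  define D where "D = (\<lambda>x. blinfun_apply (\<xi> P') x - blinfun_apply (\<xi> P) x)"
  have lin: "linear D"
    unfolding D_def by (intro linearI) (simp_all add: blinfun.add_right blinfun.scaleR_right algebra_simps)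
  have onF: "D y = c P - c P'" if "y \<in> F" for y
  proof -
    have "y \<in> P" "y \<in> P'" using that F(4,5) by blast+
    then show ?thesis
      using f(2)[OF P(1), of y] f(2)[OF P(2), of y] by (simp add: D_def)
  qed
  have ker: "D d = 0" if d: "a \<bullet> d = 0" for d
  proof (rule linear_eq_0_on_span[OF lin])
    show "d \<in> span {y - x |x y. x \<in> F \<and> y \<in> F}"
      unfolding span_facet_directions[OF facet_aff_dim(1,2)[OF fP F(1)] F(2,3)] using d by simp
    show "D v = 0" if v: "v \<in> {y - x |x y. x \<in> F \<and> y \<in> F}" for v
    proof -
      obtain x y where "v = y - x" "x \<in> F" "y \<in> F" using v by blast
      then show ?thesis using onF by (simp add: linear_diff[OF lin])
    qed
  qed
  define k where "k = D a / (a \<bullet> a)"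
  have Dk: "D x = k * (a \<bullet> x)" for x
  proof -
    have "D (x - ((a \<bullet> x) / (a \<bullet> a)) *\<^sub>R a) = 0"
      using aa by (intro ker) (simp add: inner_diff_right)
    then show ?thesis
      by (simp add: linear_diff[OF lin] linear_scale[OF lin] k_def)
  qed
  obtain x where x: "x \<in> rel_interior F"
    using rel_interior_facet_nonempty[OF fP F(1)] by blast
  then have xF: "x \<in> F" using rel_interior_subset by blast
  \<comment> \<open>Equal linear parts would force equal constants as well, because the two pieces
    agree on \<open>F\<close>; this is the form in which the breaking condition is used.\<close>
  have "k \<noteq> 0"
  proof
    assume "k = 0"
    then have "\<xi> P = \<xi> P'"
      using Dk by (intro blinfun_eqI) (simp add: D_def)
    moreover have "c P = c P'"
      using onF[OF xF] Dk \<open>k = 0\<close> by simp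
    ultimately show False using ne by simp
  qed
  moreover have "k \<ge> 0"
  proof -
    obtain e where e: "e > 0" "\<And>t. 0 < t \<Longrightarrow> t \<le> e \<Longrightarrow> x + t *\<^sub>R (- a) \<in> P"
      using facet_inner_side[OF fP n x, of "- a"] aa by auto
    obtain e' where e': "e' > 0" "\<And>t. 0 < t \<Longrightarrow> t \<le> e' \<Longrightarrow> x + t *\<^sub>R a \<in> P'"
      using facet_inner_side[OF fP' n' x, of a] aa by auto
    define t where "t = min e e'"
    have t: "0 < t" "t \<le> e" "t \<le> e'" using e(1) e'(1) by (auto simp: t_def)
    \<comment> \<open>Points placed symmetrically about \<open>x\<close> in the two cells. Convexity
      at their midpoint gives \<open>f u + f v - 2 * f x \<ge> 0\<close>, and the left side equals
      \<open>t * D a\<close>.\<close>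
    define u v where "u = x + t *\<^sub>R (- a)" and "v = x + t *\<^sub>R a"
    have uv: "u \<in> P" "v \<in> P'"
      using e(2)[OF t(1,2)] e'(2)[OF t(1,3)] by (simp_all add: u_def v_def)
    have "f ((1 - 1/2) *\<^sub>R u + (1/2) *\<^sub>R v) \<le> (1 - 1/2) * f u + (1/2) * f v"
      using uv PQ by (intro convex_onD[OF f(1)]) auto
    moreover have "(1 - 1/2) *\<^sub>R u + (1/2) *\<^sub>R v = x"
    proof -
      have "(1 - 1/2) *\<^sub>R u + (1/2) *\<^sub>R v = (1/2 :: real) *\<^sub>R (x + x)"
        by (simp add: u_def v_def algebra_simps)
      then show ?thesis by (simp add: scaleR_2[symmetric])
    qed
    ultimately have "2 * f x \<le> f u + f v" by simp
    moreover have "f x = blinfun_apply (\<xi> P) x + c P" "f x = blinfun_apply (\<xi> P') x + c P'"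
      using f(2) P xF F(4,5) by blast+
    moreover have "f u = blinfun_apply (\<xi> P) u + c P" "f v = blinfun_apply (\<xi> P') v + c P'"
      using f(2) P uv by blast+
    ultimately have "0 \<le> t * D a"
      by (simp add: D_def u_def v_def blinfun.add_right blinfun.diff_right blinfun.scaleR_right
          algebra_simps)
    then have "0 \<le> k * (a \<bullet> a)"
      using t(1) Dk[of a] by (simp add: zero_le_mult_iff)
    then show ?thesis using aa by (simp add: zero_le_mult_iff)
  qed
  ultimately show ?thesis
    using that[of k] Dk unfolding D_def by simp
qed

text \<open>The two constants are computed from prisms over the same \<open>F\<close> in directions
  \<open>a\<close> and \<open>- a\<close>, which have equal volume; only the conormal changes
  sign.\<close>

lemma weighted_normal_opposite:
  fixes Q :: "'a::euclidean_space set"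
  assumes vol: "volume_form g vol" and sub: "polyhedral_subdivision Q \<P>"
    and P: "P \<in> \<P>" "P' \<in> \<P>" "P \<noteq> P'" and F: "F facet_of P" "F facet_of P'"
  shows "weighted_normal vol P F = - weighted_normal vol P' F"
proof (rule blinfun_eqI)
  fix x
  note fP = subdivisionD(2)[OF sub P(1)] and fP' = subdivisionD(2)[OF sub P(2)]
  obtain a b where n: "facet_normal P F a b"
    using facet_normal_exists[OF fP F(1)] by blast
  have n': "facet_normal P' F (- a) (- b)"
    by (rule subdivision_opposite_normal[OF sub P n F(2)])
  obtain K where K: "\<forall>x. blinfun_apply (weighted_normal vol P F) x = K * (a \<bullet> x)"
    "\<forall>x. a \<bullet> x > 0 \<longrightarrow> K * (a \<bullet> x) = \<bar>vol basis_list\<bar> * measure lebesgue (sweep F x)"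
    using weighted_normal_eq[OF vol fP n] by blast
  obtain K' where K': "\<forall>x. blinfun_apply (weighted_normal vol P' F) x = K' * (- a \<bullet> x)"
    "\<forall>x. - a \<bullet> x > 0 \<longrightarrow> K' * (- a \<bullet> x) = \<bar>vol basis_list\<bar> * measure lebesgue (sweep F x)"
    using weighted_normal_eq[OF vol fP' n'] by blast
  have aa: "a \<bullet> a > 0" using n unfolding facet_normal_def by simp
  have "K * (a \<bullet> a) = K' * (a \<bullet> a)"
    using K(2)[THEN spec, of a] K'(2)[THEN spec, of "- a"] aa by (simp add: measure_sweep_uminus)
  then have "K = K'" using aa by simp
  then show "blinfun_apply (weighted_normal vol P F) x = blinfun_apply (- weighted_normal vol P' F) x"
    using K(1) K'(1) by (simp add: blinfun.minus_left)
qed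

text \<open>Turns the sum over edges and legs at a vertex into the sum over all facets of a cell,
  where Minkowski's relation applies: a facet is either shared, hence an edge, or lies on the
  boundary, hence a leg.\<close>

lemma dual_graph_incidence:
  fixes Q :: "'a::euclidean_space set"
  assumes sub: "polyhedral_subdivision Q \<P>" and Q: "full_dim_polytope Q" and P: "P \<in> \<P>"
  shows "{F \<in> edges (dual_graph Q \<P>) \<union> legs (dual_graph Q \<P>). P \<in> ends (dual_graph Q \<P>) F} =
    {F. F facet_of P}"
proof -
  have "F \<in> edges (dual_graph Q \<P>) \<union> legs (dual_graph Q \<P>)" if F: "F facet_of P" for F
  proof (cases "\<exists>P'\<in>\<P>. P' \<noteq> P \<and> F facet_of P'")
    case True
    then show ?thesis using P F by (auto simp: dual_graph_def)
  next
    case False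
    then have "F \<subseteq> frontier Q"
      using subdivision_boundary_facet[OF sub Q P F] by blast
    then show ?thesis using P F by (auto simp: dual_graph_def)
  qed
  then show ?thesis using P by (auto simp: dual_graph_def)
qed

lemma dual_graph_edgeE:
  assumes "polyhedral_subdivision Q \<P>" "F \<in> edges (dual_graph Q \<P>)"
  obtains P P' where "P \<in> \<P>" "P' \<in> \<P>" "P \<noteq> P'" "F facet_of P" "F facet_of P'"
    "ends (dual_graph Q \<P>) F = {P, P'}"
proof -
  obtain P P' where P: "P \<in> \<P>" "P' \<in> \<P>" "P \<noteq> P'" "F facet_of P" "F facet_of P'"
    using assms(2) by (auto simp: dual_graph_def)
  then show ?thesis
    using that subdivision_facet_shared_by_two[OF assms(1) P] by (auto simp: dual_graph_def)
qed

lemma connected_dual_graph: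
  fixes Q :: "'a::euclidean_space set"
  assumes sub: "polyhedral_subdivision Q \<P>" and Q: "full_dim_polytope Q"
  shows "connected_legged_graph (dual_graph Q \<P>)"
proof -
  let ?G = "dual_graph Q \<P>"
  have "finite (\<Union>P\<in>\<P>. {F. F facet_of P})"
    using subdivisionD(1,2)[OF sub] finite_facets by blast
  then have fin: "finite (edges ?G)" "finite (legs ?G)"
    by (auto simp: dual_graph_def elim!: finite_subset[rotated])
  have disj: "edges ?G \<inter> legs ?G = {}"
    using subdivision_internal_facet[OF sub Q] by (auto simp: dual_graph_def)
  have edge: "ends ?G e \<subseteq> verts ?G \<and> card (ends ?G e) = 2" if e: "e \<in> edges ?G" for e
  proof -
    obtain P P' where "P \<in> \<P>" "P' \<in> \<P>" "P \<noteq> P'" "ends ?G e = {P, P'}"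
      using dual_graph_edgeE[OF sub e] by metis
    then show ?thesis by (simp add: dual_graph_def)
  qed
  have leg: "ends ?G l \<subseteq> verts ?G \<and> card (ends ?G l) = 1" if l: "l \<in> legs ?G" for l
  proof -
    obtain P where P: "P \<in> \<P>" "l facet_of P" using l by (auto simp: dual_graph_def)
    have "P' = P" if "P' \<in> \<P>" "l facet_of P'" for P'
      using that P l disj by (auto simp: dual_graph_def)
    then have "{P' \<in> \<P>. l facet_of P'} = {P}"
      using P by blast
    then have "ends ?G l = {P}"
      by (simp add: dual_graph_def)
    then show ?thesis using P by (simp add: dual_graph_def)
  qed
  have "\<P> \<noteq> {}"
    using subdivisionD(3)[OF sub] full_dim_interior_nonempty[OF Q] by auto
  then show ?thesis
    using fin disj edge leg subdivisionD(1)[OF sub] dual_graph_connected[OF sub Q]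
    unfolding connected_legged_graph_def by (simp add: dual_graph_def)
qed

lemma scattering_diagram_weighted_normal:
  fixes Q :: "'a::euclidean_space set"
  assumes vol: "volume_form g vol" and sub: "polyhedral_subdivision Q \<P>" and Q: "full_dim_polytope Q"
  shows "scattering_diagram (dual_graph Q \<P>) (weighted_normal vol)"
  unfolding scattering_diagram_def
proof (intro conjI ballI allI impI)
  show "connected_legged_graph (dual_graph Q \<P>)"
    by (rule connected_dual_graph[OF sub Q])
next
  fix e v w assume e: "e \<in> edges (dual_graph Q \<P>)" "ends (dual_graph Q \<P>) e = {v, w} \<and> v \<noteq> w"
  have "v \<in> ends (dual_graph Q \<P>) e" "w \<in> ends (dual_graph Q \<P>) e"
    using e(2) by blast+
  then have "v \<in> \<P>" "w \<in> \<P>" "e facet_of v" "e facet_of w"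
    by (simp_all add: dual_graph_def)
  then show "weighted_normal vol v e = - weighted_normal vol w e"
    using weighted_normal_opposite[OF vol sub] e(2) by blast
next
  fix v assume "v \<in> verts (dual_graph Q \<P>)"
  then have "v \<in> \<P>" by (simp add: dual_graph_def)
  then show "(\<Sum>e\<in>{e \<in> edges (dual_graph Q \<P>) \<union> legs (dual_graph Q \<P>).
      v \<in> ends (dual_graph Q \<P>) e}. weighted_normal vol v e) = 0"
    unfolding dual_graph_incidence[OF sub Q \<open>v \<in> \<P>\<close>]
    by (intro sum_weighted_normals[OF vol] subdivisionD(2)[OF sub])
qed

theorem theorem6p3:
  fixes g :: "'a::euclidean_space \<Rightarrow> 'a \<Rightarrow> real"
    and vol :: "'a list \<Rightarrow> real"
    and Q :: "'a set" and \<P> :: "'a set set"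
    and m :: "'a set \<Rightarrow> real"
  assumes "euclidean_product g \<or> lorentzian_product g"
    and "volume_form g vol"
    and "full_dim_polytope Q"
    and "polyhedral_subdivision Q \<P>"
    and "\<And>F P. F \<in> edges (dual_graph Q \<P>) \<union> legs (dual_graph Q \<P>) \<Longrightarrow> P \<in> ends (dual_graph Q \<P>) F \<Longrightarrow>
           0 \<le> dual_product g (weighted_normal vol P F) (weighted_normal vol P F)"
    and "\<And>F P. F \<in> edges (dual_graph Q \<P>) \<union> legs (dual_graph Q \<P>) \<Longrightarrow> P \<in> ends (dual_graph Q \<P>) F \<Longrightarrow>
           m F = sqrt (dual_product g (weighted_normal vol P F) (weighted_normal vol P F))"
    and "regular_subdivision Q \<P>"
  shows "real_Landau_singularity (dual_graph Q \<P>) (dual_product g) m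
           (external_momenta (dual_graph Q \<P>) (weighted_normal vol)) (weighted_normal vol)"
proof -
  let ?G = "dual_graph Q \<P>"
  note vol = assms(2) and sub = assms(4)
  obtain f \<xi> c where f: "convex_on Q f"
    and affine: "\<forall>P\<in>\<P>. \<forall>x\<in>P. f x = blinfun_apply (\<xi> P) x + c P"
    and break: "\<forall>P\<in>\<P>. \<forall>P'\<in>\<P>. \<forall>F. P \<noteq> P' \<and> F facet_of P \<and> F facet_of P' \<longrightarrow>
      (\<xi> P, c P) \<noteq> (\<xi> P', c P')"
    using assms(7) unfolding regular_subdivision_def by (elim exE conjE) (rule that)
  define \<phi> where "\<phi> P = - \<xi> P" for P
  have "\<exists>\<alpha>>0. \<forall>v w. ends ?G e = {v, w} \<and> v \<noteq> w \<longrightarrow>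
      \<alpha> *\<^sub>R weighted_normal vol v e = \<phi> v - \<phi> w" if e: "e \<in> edges ?G" for e
  proof -
    obtain P P' where P: "P \<in> \<P>" "P' \<in> \<P>" "P \<noteq> P'" "e facet_of P" "e facet_of P'"
      and ends: "ends ?G e = {P, P'}"
      using dual_graph_edgeE[OF sub e] by blast
    obtain a b where n: "facet_normal P e a b"
      using facet_normal_exists[OF subdivisionD(2)[OF sub P(1)] P(4)] by blast
    obtain K where K: "K > 0" "\<forall>x. blinfun_apply (weighted_normal vol P e) x = K * (a \<bullet> x)"
      using weighted_normal_eq[OF vol subdivisionD(2)[OF sub P(1)] n] by blast
    obtain k where k: "k > 0"
      "\<And>x. blinfun_apply (\<xi> P') x - blinfun_apply (\<xi> P) x = k * (a \<bullet> x)"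
      using regular_jump[OF sub P(1-3) n P(5) f, of \<xi> c] affine break P by blast
    \<comment> \<open>Measured against the same conormal \<open>a\<close>, the weighted normal has
      size \<open>K\<close> and the jump of the gradient has size \<open>k\<close>; the Landau
      multiplier is their ratio.\<close>
    have eq: "(k / K) *\<^sub>R weighted_normal vol P e = \<phi> P - \<phi> P'"
      using K k by (intro blinfun_eqI)
        (simp add: \<phi>_def blinfun.scaleR_left blinfun.diff_left blinfun.minus_left)
    have opp: "weighted_normal vol P' e = - weighted_normal vol P e"
      using weighted_normal_opposite[OF vol sub P] by simp
    \<comment> \<open>The same multiplier must serve both ends of the edge; reversing the edge
      changes the sign of both sides.\<close>
    have eq': "(k / K) *\<^sub>R weighted_normal vol P' e = \<phi> P' - \<phi> P"
      using eq unfolding opp by (simp add: minus_equation_iff[of "\<phi> P - \<phi> P'"])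
    have "v = P \<and> w = P' \<or> v = P' \<and> w = P" if "ends ?G e = {v, w} \<and> v \<noteq> w" for v w
      using that ends by (auto simp: doubleton_eq_iff)
    then show ?thesis
      using eq eq' K(1) k(1) by (intro exI[of _ "k / K"]) auto
  qed
  then have landau: "\<exists>\<alpha>. (\<forall>e\<in>edges ?G. \<alpha> e > 0) \<and> (\<forall>e\<in>edges ?G. \<forall>v w. ends ?G e = {v, w} \<and> v \<noteq> w \<longrightarrow>
      \<alpha> e *\<^sub>R weighted_normal vol v e = \<phi> v - \<phi> w)"
    by metis
  have mass: "0 \<le> m e" if e: "e \<in> edges ?G \<union> legs ?G" for e
  proof -
    obtain P where "P \<in> ends ?G e"
      using e by (auto simp: dual_graph_def)
    then show ?thesis
      using assms(5,6)[OF e] by simp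
  qed
  have shell: "dual_product g (weighted_normal vol v e) (weighted_normal vol v e) = (m e)\<^sup>2"
    if "e \<in> edges ?G" "v \<in> ends ?G e" for e v
    using assms(5,6)[of e v] that by simp
  show ?thesis
    unfolding real_Landau_singularity_def
  proof (intro conjI ballI)
    show "scattering_diagram ?G (weighted_normal vol)"
      by (rule scattering_diagram_weighted_normal[OF vol sub assms(3)])
    show "\<exists>\<alpha> \<phi>. (\<forall>e\<in>edges ?G. \<alpha> e > 0) \<and> (\<forall>e\<in>edges ?G. \<forall>v w. ends ?G e = {v, w} \<and> v \<noteq> w \<longrightarrow>
        \<alpha> e *\<^sub>R weighted_normal vol v e = \<phi> v - \<phi> w)"
      using landau by (elim exE) (intro exI)
  qed (simp_all add: mass shell)
qed

end
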